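(* Consider a sequence of finite populations indexed by $N\to\infty$. For each $N$, units $i=1,\dots,N$ have fixed potential outcomes $Y_{i,1}(z_1)$, $z_1\in\{c,v_1,v_2\}$, and $Y_{i,2}(z_1,z_2)$, $(z_1,z_2)\in\{(c,c),(c,v_2),(v_1,v_2)\}$, satisfying $Y_{i,2}(c,v)-Y_{i,2}(c,c)=Y_{i,1}(v)-Y_{i,1}(c)$ for $v\in\{v_1,v_2\}$. Treatment paths are assigned by the two-iteration stepped-wedge completely randomized design: a uniformly random set of $N_{v_1}$ units gets path $(v_1,v_2)$, a uniformly random set of $N_{c,v_2}$ of the remaining units gets path $(c,v_2)$, and the other $N_{c,c}$ units get $(c,c)$, with $N_{v_1}<N_{v_1}+N_{c,v_2}$ i.e. all three groups nonempty. Observed outcomes are $Y^{\mathrm{obs}}_{i,1}=Y_{i,1}(Z_{i,1})$, $Y^{\mathrm{obs}}_{i,2}=Y_{i,2}(Z_{i,1},Z_{i,2})$. Let $\tau_1=\frac1N\sum_i[Y_{i,1}(v_2)-Y_{i,1}(v_1)]$ and $$\hat\tau_1=\frac{1}{N_{c,v_2}}\sum_{i:\mathbf{Z}_i=(c,v_2)}Y^{\mathrm{obs}}_{i,2}-\frac{1}{N_{v_1}}\sum_{i:Z_{i,1}=v_1}Y^{\mathrm{obs}}_{i,1}-\frac{1}{N_{c,c}}\sum_{i:\mathbf{Z}_i=(c,c)}(Y^{\mathrm{obs}}_{i,2}-Y^{\mathrm{obs}}_{i,1}).$$ Let $s^2_{c,v_2}$ be the sample variance (divisor $N_{c,v_2}-1$)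 of $Y^{\mathrm{obs}}_{i,2}$ over units with $\mathbf{Z}_i=(c,v_2)$, $s^2_{v_1}$ the sample variance (divisor $N_{v_1}-1$) of $Y^{\mathrm{obs}}_{i,1}$ over units with $Z_{i,1}=v_1$, $s^2_\Delta$ the sample variance (divisor $N_{c,c}-1$) of $Y^{\mathrm{obs}}_{i,2}-Y^{\mathrm{obs}}_{i,1}$ over units with $\mathbf{Z}_i=(c,c)$, and $\hat V_{\tau_1}=s^2_{c,v_2}/N_{c,v_2}+s^2_{v_1}/N_{v_1}+s^2_\Delta/N_{c,c}$. Assume the regularity conditions: as $N\to\infty$, (i) $N_{v_1}/N$, $N_{c,v_2}/N$, $N_{c,c}/N$ converge to limits in $(0,1)$; (ii) with $a_i=Y_{i,1}(v_1)$, $b_i=Y_{i,2}(c,v_2)$, $d_i=Y_{i,2}(c,c)-Y_{i,1}(c)$, the finite-population variances and covariances $\frac{1}{N-1}\sum_i(x_i-\bar x)(y_i-\bar y)$ for $x,y\in\{a,b,d\}$ converge to finite limits, and the limit of $N\,\mathbb{V}[\hat\tau_1]$ is positive; (iii) $\max_{1\le i\le N}(x_i-\bar x)^2/N\to0$ for each $x\in\{a,b,d\}$. Then for every $\alpha\in(0,1)$, the Wald-type interval $(\hat\tau_1-z_{\alpha/2}\hat V_{\tau_1}^{1/2},\ \hat\tau_1+z_{\alpha/2}\hat V_{\tau_1}^{1/2})$ satisfies $\liminf_{N\to\infty}\Pr(\tau_1\in\text{interval})\ge1-\alpha$, where $z_{\alpha/2}$ is the $(1-\alpha/2)$ quantile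 of the standard normal distribution.
   Context: Probabilities are over the random assignment only; potential outcomes are fixed (design-based finite-population framework). The notation $Y_{i,1}(Z_{i,1})$, $Y_{i,2}(Z_{i,1},Z_{i,2})$ encodes non-anticipation and no-interference. $\bar x=\frac1N\sum_i x_i$. *)

theory Defs
  imports "HOL-Probability.Probability"
begin

datatype trt = C | V1 | V2
datatype path = PCC | PCV2 | PV1V2

fun z1 :: "path \<Rightarrow> trt" where
  "z1 PCC = C" | "z1 PCV2 = C" | "z1 PV1V2 = V1"
fun z2 :: "path \<Rightarrow> trt" where
  "z2 PCC = C" | "z2 PCV2 = V2" | "z2 PV1V2 = V2"

text \<open>Assignments of paths to units 0..N-1 (extensional: PCC outside) with
  prescribed group sizes; the completely randomized stepped-wedge design is
  the uniform distribution on this set.\<close>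
definition assignments :: "nat \<Rightarrow> nat \<Rightarrow> nat \<Rightarrow> nat \<Rightarrow> (nat \<Rightarrow> path) set" where
  "assignments N nv1 ncv2 ncc =
     {Z. (\<forall>i. N \<le> i \<longrightarrow> Z i = PCC)
       \<and> card {i. i < N \<and> Z i = PV1V2} = nv1
       \<and> card {i. i < N \<and> Z i = PCV2} = ncv2
       \<and> card {i. i < N \<and> Z i = PCC} = ncc}"

definition design :: "nat \<Rightarrow> nat \<Rightarrow> nat \<Rightarrow> nat \<Rightarrow> (nat \<Rightarrow> path) pmf" where
  "design N nv1 ncv2 ncc = pmf_of_set (assignments N nv1 ncv2 ncc)"

definition group :: "nat \<Rightarrow> (nat \<Rightarrow> path) \<Rightarrow> path \<Rightarrow> nat set" where
  "group N Z p = {i. i < N \<and> Z i = p}"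

definition smean :: "nat set \<Rightarrow> (nat \<Rightarrow> real) \<Rightarrow> real" where
  "smean S f = (\<Sum>i\<in>S. f i) / real (card S)"

definition svar :: "nat set \<Rightarrow> (nat \<Rightarrow> real) \<Rightarrow> real" where
  "svar S f = (\<Sum>i\<in>S. (f i - smean S f)^2) / (real (card S) - 1)"

definition pmean :: "nat \<Rightarrow> (nat \<Rightarrow> real) \<Rightarrow> real" where
  "pmean N x = (\<Sum>i<N. x i) / real N"

definition pcov :: "nat \<Rightarrow> (nat \<Rightarrow> real) \<Rightarrow> (nat \<Rightarrow> real) \<Rightarrow> real" where
  "pcov N x y = (\<Sum>i<N. (x i - pmean N x) * (y i - pmean N y)) / (real N - 1)"

definition tau_hat :: "nat \<Rightarrow> nat \<Rightarrow> nat \<Rightarrow> nat \<Rightarrow> (nat \<Rightarrow> trt \<Rightarrow> real)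
    \<Rightarrow> (nat \<Rightarrow> trt \<Rightarrow> trt \<Rightarrow> real) \<Rightarrow> (nat \<Rightarrow> path) \<Rightarrow> real" where
  "tau_hat N nv1 ncv2 ncc Y1 Y2 Z =
     (let Yo1 = (\<lambda>i. Y1 i (z1 (Z i))); Yo2 = (\<lambda>i. Y2 i (z1 (Z i)) (z2 (Z i))) in
      (\<Sum>i\<in>group N Z PCV2. Yo2 i) / real ncv2
      - (\<Sum>i\<in>{i. i < N \<and> z1 (Z i) = V1}. Yo1 i) / real nv1
      - (\<Sum>i\<in>group N Z PCC. Yo2 i - Yo1 i) / real ncc)"

definition V_hat :: "nat \<Rightarrow> nat \<Rightarrow> nat \<Rightarrow> nat \<Rightarrow> (nat \<Rightarrow> trt \<Rightarrow> real)
    \<Rightarrow> (nat \<Rightarrow> trt \<Rightarrow> trt \<Rightarrow> real) \<Rightarrow> (nat \<Rightarrow> path) \<Rightarrow> real" where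
  "V_hat N nv1 ncv2 ncc Y1 Y2 Z =
     (let Yo1 = (\<lambda>i. Y1 i (z1 (Z i))); Yo2 = (\<lambda>i. Y2 i (z1 (Z i)) (z2 (Z i))) in
      svar (group N Z PCV2) Yo2 / real ncv2
      + svar {i. i < N \<and> z1 (Z i) = V1} Yo1 / real nv1
      + svar (group N Z PCC) (\<lambda>i. Yo2 i - Yo1 i) / real ncc)"

definition Phi :: "real \<Rightarrow> real" where
  "Phi x = (LINT t:{..x}|lborel. std_normal_density t)"

definition normal_quantile :: "real \<Rightarrow> real" where
  "normal_quantile p = (THE z. Phi z = p)"

end

theory Submission
  imports Defs "HOL-Combinatorics.Permutations" "HOL-Real_Asymp.Real_Asymp"
begin

text \<open>
  The design is the law of a fixed labelling \<open>b\<close> of the positions \<open>{..<N}\<close>, sorted into blocks of the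
  prescribed sizes, composed with a uniformly random permutation \<open>\<pi>\<close>, and the centred estimator is
  a sum \<open>S = (\<Sum>i<N. w i (b (\<pi> i)))\<close> in which \<open>(\<Sum>i<N. w i p) = 0\<close> for every path \<open>p\<close>.
  Following Hajek, \<open>S\<close> is coupled with the same statistic under independent assignments: if \<open>z\<close> is an
  independent assignment and \<open>b'\<close> its sorted version, then \<open>b' \<circ> \<pi>\<close> has the law of \<open>z\<close>.
  As \<open>b\<close> and \<open>b'\<close> differ in only \<open>O(sqrt N)\<close> positions on average, the centring makes the two
  statistics differ by \<open>o(1)\<close> standard deviations in mean square. The central limit theorem for the
  independent version follows from characteristic functions and carries over to \<open>S\<close>.

  Second moments of permutation sums also show that the sample variances are consistent for the
  finite-population variances, so that \<open>N * V_hat\<close> is asymptotically at least the limit of \<open>N\<close> times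
  the variance of the estimator, and Slutsky's argument gives the coverage.
\<close>

section \<open>Uniformly random permutations\<close>

definition perm_pmf :: "nat \<Rightarrow> (nat \<Rightarrow> nat) pmf" where
  "perm_pmf N = pmf_of_set {\<pi>. \<pi> permutes {..<N}}"

lemma set_perm_pmf: "set_pmf (perm_pmf N) = {\<pi>. \<pi> permutes {..<N}}"
  unfolding perm_pmf_def
  by (rule set_pmf_of_set) (use permutes_id finite_permutations[of "{..<N}"] in blast)+

lemma finite_set_perm_pmf: "finite (set_pmf (perm_pmf N))"
  by (simp add: set_perm_pmf finite_permutations)

lemma integrable_perm_pmf [simp]:
  fixes f :: "_ \<Rightarrow> 'b::{banach, second_countable_topology}"
  shows "integrable (measure_pmf (perm_pmf N)) f"
  by (rule integrable_measure_pmf_finite[OF finite_set_perm_pmf])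

lemma map_perm_pmf_comp:
  assumes "\<rho> permutes {..<N}"
  shows "map_pmf (\<lambda>\<pi>. \<rho> \<circ> \<pi>) (perm_pmf N) = perm_pmf N"
    and "map_pmf (\<lambda>\<pi>. \<pi> \<circ> \<rho>) (perm_pmf N) = perm_pmf N"
proof -
  have fin: "finite {\<pi>. \<pi> permutes {..<N}}" "{\<pi>. \<pi> permutes {..<N}} \<noteq> {}"
    using finite_permutations[of "{..<N}"] permutes_id by blast+
  have "inj_on (\<lambda>\<pi>. \<rho> \<circ> \<pi>) {\<pi>. \<pi> permutes {..<N}}"
    using permutes_inj[OF assms] by (auto simp: inj_on_def fun_eq_iff inj_def)
  moreover have "(\<lambda>\<pi>. \<rho> \<circ> \<pi>) ` {\<pi>. \<pi> permutes {..<N}} = {\<pi>. \<pi> permutes {..<N}}"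
    using image_compose_permutations_left[OF assms] by (simp add: setcompr_eq_image)
  ultimately show "map_pmf (\<lambda>\<pi>. \<rho> \<circ> \<pi>) (perm_pmf N) = perm_pmf N"
    unfolding perm_pmf_def using map_pmf_of_set_inj[OF _ fin(2,1)] by metis
  have "inj_on (\<lambda>\<pi>. \<pi> \<circ> \<rho>) {\<pi>. \<pi> permutes {..<N}}"
    using permutes_surj[OF assms] by (auto simp: inj_on_def fun.inj_map_strong)
      (metis assms comp_assoc comp_id permutes_inv_o(1))
  moreover have "(\<lambda>\<pi>. \<pi> \<circ> \<rho>) ` {\<pi>. \<pi> permutes {..<N}} = {\<pi>. \<pi> permutes {..<N}}"
    using image_compose_permutations_right[OF assms] by (simp add: setcompr_eq_image)
  ultimately show "map_pmf (\<lambda>\<pi>. \<pi> \<circ> \<rho>) (perm_pmf N) = perm_pmf N"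
    unfolding perm_pmf_def using map_pmf_of_set_inj[OF _ fin(2,1)] by metis
qed

lemma map_perm_pmf_inv: "map_pmf inv (perm_pmf N) = perm_pmf N"
proof -
  have fin: "finite {\<pi>. \<pi> permutes {..<N}}" "{\<pi>. \<pi> permutes {..<N}} \<noteq> {}"
    using finite_permutations[of "{..<N}"] permutes_id by blast+
  have "inj_on inv {\<pi>. \<pi> permutes {..<N}}"
    by (rule inj_on_inverseI[of _ inv]) (auto simp: permutes_inv_inv)
  moreover have "inv ` {\<pi>. \<pi> permutes {..<N}} = {\<pi>. \<pi> permutes {..<N}}"
    using image_inverse_permutations[of "{..<N}"] by (simp add: setcompr_eq_image)
  ultimately show ?thesis
    unfolding perm_pmf_def using map_pmf_of_set_inj[OF _ fin(2,1)] by metis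
qed

lemma expectation_perm_comp_right:
  fixes f :: "_ \<Rightarrow> real"
  assumes "\<rho> permutes {..<N}"
  shows "measure_pmf.expectation (perm_pmf N) (\<lambda>\<pi>. f (\<pi> \<circ> \<rho>)) = measure_pmf.expectation (perm_pmf N) f"
proof -
  have "measure_pmf.expectation (perm_pmf N) f
      = measure_pmf.expectation (map_pmf (\<lambda>\<pi>. \<pi> \<circ> \<rho>) (perm_pmf N)) f"
    using map_perm_pmf_comp(2)[OF assms] by simp
  then show ?thesis by simp
qed

lemma expectation_perm_inv:
  fixes f :: "_ \<Rightarrow> real"
  shows "measure_pmf.expectation (perm_pmf N) (\<lambda>\<pi>. f (inv \<pi>)) = measure_pmf.expectation (perm_pmf N) f"
proof -
  have "measure_pmf.expectation (perm_pmf N) f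
      = measure_pmf.expectation (map_pmf inv (perm_pmf N)) f"
    using map_perm_pmf_inv by simp
  then show ?thesis by simp
qed

lemma expectation_perm_cong:
  assumes "\<And>\<pi>. \<pi> permutes {..<N} \<Longrightarrow> f \<pi> = g \<pi>"
  shows "measure_pmf.expectation (perm_pmf N) f = measure_pmf.expectation (perm_pmf N) g"
  by (rule integral_cong_AE) (auto simp: AE_measure_pmf_iff set_perm_pmf assms)

lemma expectation_perm_point:
  fixes f :: "nat \<Rightarrow> real"
  assumes k: "k < N"
  shows "measure_pmf.expectation (perm_pmf N) (\<lambda>\<pi>. f (\<pi> k)) = (\<Sum>i<N. f i) / real N"
proof -
  let ?E = "measure_pmf.expectation (perm_pmf N)"
  have "?E (\<lambda>\<pi>. f (\<pi> k)) = ?E (\<lambda>\<pi>. f (\<pi> j))" if "j < N" for j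
    using expectation_perm_comp_right[of "Transposition.transpose j k" N "\<lambda>\<pi>. f (\<pi> j)"] that k
    by (simp add: permutes_swap_id)
  then have "(\<Sum>j<N. ?E (\<lambda>\<pi>. f (\<pi> k))) = (\<Sum>j<N. ?E (\<lambda>\<pi>. f (\<pi> j)))"
    by (intro sum.cong) auto
  then have "real N * ?E (\<lambda>\<pi>. f (\<pi> k)) = (\<Sum>j<N. ?E (\<lambda>\<pi>. f (\<pi> j)))"
    by simp
  also have "\<dots> = ?E (\<lambda>\<pi>. \<Sum>j<N. f (\<pi> j))" by simp
  also have "\<dots> = ?E (\<lambda>\<pi>. \<Sum>i<N. f i)"
    by (rule expectation_perm_cong) (simp add: sum.permute[symmetric, unfolded o_def])
  finally show ?thesis using k by (simp add: field_simps)
qed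

lemma expectation_perm_pair:
  fixes f g :: "nat \<Rightarrow> real"
  assumes k: "k < N" and l: "l < N" and kl: "k \<noteq> l" and g: "(\<Sum>i<N. g i) = 0"
  shows "measure_pmf.expectation (perm_pmf N) (\<lambda>\<pi>. f (\<pi> k) * g (\<pi> l))
       = - (\<Sum>i<N. f i * g i) / (real N * (real N - 1))"
proof -
  let ?E = "measure_pmf.expectation (perm_pmf N)"
  let ?e = "?E (\<lambda>\<pi>. f (\<pi> k) * g (\<pi> l))"
  have N: "N \<ge> 2" using k l kl by linarith
  have "?e = ?E (\<lambda>\<pi>. f (\<pi> k) * g (\<pi> j))" if "j \<in> {..<N} - {k}" for j
    using expectation_perm_comp_right[of "Transposition.transpose j l" N "\<lambda>\<pi>. f (\<pi> k) * g (\<pi> j)"] that l kl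
    by (auto simp: permutes_swap_id)
  then have "(\<Sum>j\<in>{..<N} - {k}. ?e) = (\<Sum>j\<in>{..<N} - {k}. ?E (\<lambda>\<pi>. f (\<pi> k) * g (\<pi> j)))"
    by (intro sum.cong) auto
  then have "(real N - 1) * ?e = (\<Sum>j\<in>{..<N} - {k}. ?E (\<lambda>\<pi>. f (\<pi> k) * g (\<pi> j)))"
    using k N by (simp add: of_nat_diff)
  also have "\<dots> = ?E (\<lambda>\<pi>. f (\<pi> k) * (\<Sum>j\<in>{..<N} - {k}. g (\<pi> j)))"
    by (simp add: sum_distrib_left)
  also have "\<dots> = ?E (\<lambda>\<pi>. - (f (\<pi> k) * g (\<pi> k)))"
  proof (rule expectation_perm_cong)
    fix \<pi> assume p: "\<pi> permutes {..<N}"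
    have "(\<Sum>j\<in>{..<N}. g (\<pi> j)) = 0"
      using g p by (simp add: sum.permute[symmetric, unfolded o_def])
    then have "(\<Sum>j\<in>{..<N} - {k}. g (\<pi> j)) = - g (\<pi> k)"
      using k by (simp add: sum_diff1)
    then show "f (\<pi> k) * (\<Sum>j\<in>{..<N} - {k}. g (\<pi> j)) = - (f (\<pi> k) * g (\<pi> k))" by simp
  qed
  also have "\<dots> = - (\<Sum>i<N. f i * g i) / real N"
    using expectation_perm_point[OF k, of "\<lambda>i. f i * g i"] by simp
  finally have "(real N - 1) * ?e = - (\<Sum>i<N. f i * g i) / real N" .
  moreover have "real N - 1 > 0" using N by simp
  ultimately show ?thesis by (simp add: field_simps)
qed

lemma sum_permutes_inv:
  assumes "\<pi> permutes {..<N::nat}"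
  shows "(\<Sum>i<N. m i (inv \<pi> i)) = (\<Sum>k<N. m (\<pi> k) k)"
  using assms by (metis sum.permutes_inv)

lemma expectation_perm_sum:
  fixes m :: "nat \<Rightarrow> nat \<Rightarrow> real"
  assumes "\<And>k. k < N \<Longrightarrow> (\<Sum>i<N. m i k) = 0"
  shows "measure_pmf.expectation (perm_pmf N) (\<lambda>\<pi>. \<Sum>i<N. m i (\<pi> i)) = 0"
proof -
  have "measure_pmf.expectation (perm_pmf N) (\<lambda>\<pi>. \<Sum>i<N. m i (\<pi> i))
      = measure_pmf.expectation (perm_pmf N) (\<lambda>\<pi>. \<Sum>i<N. m i (inv \<pi> i))"
    by (rule expectation_perm_inv[symmetric])
  also have "\<dots> = measure_pmf.expectation (perm_pmf N) (\<lambda>\<pi>. \<Sum>k<N. m (\<pi> k) k)"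
    by (rule expectation_perm_cong) (rule sum_permutes_inv)
  also have "\<dots> = (\<Sum>k<N. (\<Sum>i<N. m i k) / real N)"
    using expectation_perm_point[of _ N "\<lambda>i. m i k" for k] by simp
  finally show ?thesis using assms by simp
qed

lemma expectation_perm_sum_square:
  fixes m :: "nat \<Rightarrow> nat \<Rightarrow> real"
  assumes N: "N \<ge> 2" and m: "\<And>k. k < N \<Longrightarrow> (\<Sum>i<N. m i k) = 0"
  shows "measure_pmf.expectation (perm_pmf N) (\<lambda>\<pi>. (\<Sum>i<N. m i (\<pi> i))\<^sup>2)
       = ((\<Sum>i<N. \<Sum>k<N. (m i k)\<^sup>2) - (\<Sum>i<N. (\<Sum>k<N. m i k)\<^sup>2) / real N) / (real N - 1)"
proof -
  let ?E = "measure_pmf.expectation (perm_pmf N)"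
  define D where "D k = (\<Sum>i<N. (m i k)\<^sup>2)" for k
  define P where "P k l = (\<Sum>i<N. m i k * m i l)" for k l
  have N1: "real N - 1 > 0" "real N > 0" using N by simp_all
  have "?E (\<lambda>\<pi>. (\<Sum>i<N. m i (\<pi> i))\<^sup>2) = ?E (\<lambda>\<pi>. (\<Sum>i<N. m i (inv \<pi> i))\<^sup>2)"
    by (rule expectation_perm_inv[symmetric])
  also have "\<dots> = ?E (\<lambda>\<pi>. \<Sum>k<N. \<Sum>l<N. m (\<pi> k) k * m (\<pi> l) l)"
    by (rule expectation_perm_cong) (simp add: sum_permutes_inv power2_eq_square sum_product)
  also have "\<dots> = (\<Sum>k<N. \<Sum>l<N. ?E (\<lambda>\<pi>. m (\<pi> k) k * m (\<pi> l) l))"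
    by simp
  also have "\<dots> = (\<Sum>k<N. \<Sum>l<N. (if l = k then D k / (real N - 1) else 0) - P k l / (real N * (real N - 1)))"
  proof (intro sum.cong refl)
    fix k l assume kl: "k \<in> {..<N}" "l \<in> {..<N}"
    show "?E (\<lambda>\<pi>. m (\<pi> k) k * m (\<pi> l) l)
        = (if l = k then D k / (real N - 1) else 0) - P k l / (real N * (real N - 1))"
    proof (cases "l = k")
      case True
      have "?E (\<lambda>\<pi>. m (\<pi> k) k * m (\<pi> k) k) = D k / real N"
        using expectation_perm_point[of k N "\<lambda>i. m i k * m i k"] kl
        by (simp add: D_def power2_eq_square)
      moreover have "P k k = D k" by (simp add: P_def D_def power2_eq_square)
      ultimately show ?thesis using True N1 by (simp add: divide_simps) (simp add: algebra_simps)
    next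
      case False
      then show ?thesis
        using expectation_perm_pair[of k N l "\<lambda>i. m i l" "\<lambda>i. m i k"] m[of l] kl
        by (simp add: P_def)
    qed
  qed
  also have "\<dots> = (\<Sum>k<N. D k / (real N - 1)) - (\<Sum>k<N. \<Sum>l<N. P k l / (real N * (real N - 1)))"
    by (simp add: sum_subtractf)
  also have "\<dots> = (\<Sum>k<N. D k) / (real N - 1) - (\<Sum>k<N. \<Sum>l<N. P k l) / (real N * (real N - 1))"
    by (simp add: sum_divide_distrib)
  also have "(\<Sum>k<N. D k) = (\<Sum>i<N. \<Sum>k<N. (m i k)\<^sup>2)"
    unfolding D_def by (rule sum.swap)
  also have "(\<Sum>k<N. \<Sum>l<N. P k l) = (\<Sum>i<N. (\<Sum>k<N. m i k)\<^sup>2)"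
  proof -
    have "(\<Sum>k<N. \<Sum>l<N. P k l) = (\<Sum>k<N. \<Sum>i<N. \<Sum>l<N. m i k * m i l)"
      unfolding P_def by (intro sum.cong refl sum.swap)
    also have "\<dots> = (\<Sum>i<N. \<Sum>k<N. \<Sum>l<N. m i k * m i l)" by (rule sum.swap)
    finally show ?thesis by (simp add: power2_eq_square sum_product)
  qed
  finally show ?thesis by (simp add: diff_divide_distrib)
qed

lemma expectation_perm_sum_square_le:
  fixes m :: "nat \<Rightarrow> nat \<Rightarrow> real"
  assumes "N \<ge> 2" and "\<And>k. k < N \<Longrightarrow> (\<Sum>i<N. m i k) = 0"
  shows "measure_pmf.expectation (perm_pmf N) (\<lambda>\<pi>. (\<Sum>i<N. m i (\<pi> i))\<^sup>2)
       \<le> (\<Sum>i<N. \<Sum>k<N. (m i k)\<^sup>2) / (real N - 1)"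
  by (subst expectation_perm_sum_square)
    (use assms in \<open>auto intro!: divide_right_mono sum_nonneg divide_nonneg_nonneg\<close>)

section \<open>Random permutations and treatment assignments\<close>

lemma expectation_bind_pmf_finite:
  fixes h :: "'b \<Rightarrow> 'c::{banach, second_countable_topology}"
  assumes "finite (set_pmf p)" "\<And>x. x \<in> set_pmf p \<Longrightarrow> finite (set_pmf (f x))"
  shows "measure_pmf.expectation (bind_pmf p f) h
       = measure_pmf.expectation p (\<lambda>x. measure_pmf.expectation (f x) h)"
  using assms
  by (subst pmf_expectation_bind[of "set_pmf p"]) (auto simp: integral_measure_pmf[of "set_pmf p"])

lemma expectation_pair_pmf_finite:
  fixes h :: "'a \<times> 'b \<Rightarrow> 'c::{banach, second_countable_topology}"
  assumes "finite (set_pmf p)" "finite (set_pmf q)"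
  shows "measure_pmf.expectation (pair_pmf p q) h
       = measure_pmf.expectation p (\<lambda>x. measure_pmf.expectation q (\<lambda>y. h (x, y)))"
proof -
  have "pair_pmf p q = bind_pmf p (\<lambda>x. map_pmf (Pair x) q)"
    by (simp add: pair_pmf_def map_pmf_def)
  then show ?thesis
    using assms by (simp add: expectation_bind_pmf_finite)
qed

lemma expectation_abs_le_sqrt:
  fixes X :: "'a \<Rightarrow> real"
  assumes "finite (set_pmf p)"
  shows "measure_pmf.expectation p (\<lambda>x. \<bar>X x\<bar>) \<le> sqrt (measure_pmf.expectation p (\<lambda>x. (X x)\<^sup>2))"
proof -
  have "0 \<le> measure_pmf.variance p (\<lambda>x. \<bar>X x\<bar>)"
    by (rule measure_pmf.variance_positive)
  also have "\<dots> = measure_pmf.expectation p (\<lambda>x. (X x)\<^sup>2)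
      - (measure_pmf.expectation p (\<lambda>x. \<bar>X x\<bar>))\<^sup>2"
    by (subst measure_pmf.variance_eq) (auto intro: integrable_measure_pmf_finite assms)
  finally show ?thesis by (intro real_le_rsqrt) simp
qed

lemma pmf_eq_pmf_of_set:
  assumes fin: "finite (set_pmf p)" and const: "\<And>x. x \<in> set_pmf p \<Longrightarrow> pmf p x = r"
  shows "p = pmf_of_set (set_pmf p)"
proof (rule pmf_eqI)
  fix x
  have "(\<Sum>x\<in>set_pmf p. pmf p x) = 1" using fin by (intro sum_pmf_eq_1) auto
  then have "real (card (set_pmf p)) * r = 1" using const by simp
  then have "r = 1 / real (card (set_pmf p))"
    by (metis mult.commute mult_zero_right nonzero_eq_divide_eq zero_neq_one)
  then show "pmf p x = pmf (pmf_of_set (set_pmf p)) x"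
    using const[of x] fin set_pmf_not_empty[of p]
    by (auto simp: indicator_def set_pmf_iff)
qed

lemma relabel_permutes:
  fixes f g :: "nat \<Rightarrow> path"
  assumes "\<And>p. card (group N f p) = card (group N g p)"
    and "\<And>i. i \<ge> N \<Longrightarrow> f i = g i"
  obtains \<rho> where "\<rho> permutes {..<N}" "f = g \<circ> \<rho>"
proof -
  have eq: "{a \<in> {..<N}. h a = p} = group N h p" for h p
    by (auto simp: group_def)
  have "image_mset f (mset_set {..<N}) = image_mset g (mset_set {..<N})"
    by (rule multiset_eqI) (simp only: count_image_mset_eq_card_vimage finite_lessThan eq assms)
  then obtain \<rho> where \<rho>: "\<rho> permutes {..<N}" "\<forall>i\<in>{..<N}. f i = g (\<rho> i)"
    using image_mset_eq_implies_permutes[of "{..<N}" f g] by blast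
  have "f i = (g \<circ> \<rho>) i" for i
    using \<rho> assms(2)[of i] permutes_not_in[OF \<rho>(1), of i] by (cases "i < N") auto
  then show ?thesis using that \<rho>(1) by blast
qed

lemma card_group_comp:
  assumes "\<rho> permutes {..<N}"
  shows "card (group N (Z \<circ> \<rho>) p) = card (group N Z p)"
proof (rule bij_betw_same_card[of \<rho>], rule bij_betw_imageI)
  show "inj_on \<rho> (group N (Z \<circ> \<rho>) p)" using permutes_inj_on[OF assms] by blast
  show "\<rho> ` group N (Z \<circ> \<rho>) p = group N Z p"
  proof (intro equalityI subsetI)
    fix j assume "j \<in> group N Z p"
    then have "inv \<rho> j \<in> group N (Z \<circ> \<rho>) p" "j = \<rho> (inv \<rho> j)"
      using permutes_in_image[OF permutes_inv[OF assms], of j] permutes_inverses[OF assms]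
      by (auto simp: group_def)
    then show "j \<in> \<rho> ` group N (Z \<circ> \<rho>) p" by blast
  qed (use permutes_in_image[OF assms] in \<open>auto simp: group_def\<close>)
qed

definition block_path :: "nat \<Rightarrow> nat \<Rightarrow> nat \<Rightarrow> path" where
  "block_path n1 n2 k = (if k < n1 then PV1V2 else if k < n1 + n2 then PCV2 else PCC)"

lemma card_group_block_path:
  assumes "n1 + n2 + n3 = N"
  shows "card (group N (block_path n1 n2) PV1V2) = n1"
    and "card (group N (block_path n1 n2) PCV2) = n2"
    and "card (group N (block_path n1 n2) PCC) = n3"
proof -
  have "group N (block_path n1 n2) PV1V2 = {..<n1}" "group N (block_path n1 n2) PCV2 = {n1..<n1+n2}"
    "group N (block_path n1 n2) PCC = {n1+n2..<N}"
    using assms by (auto simp: group_def block_path_def split: if_splits)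
  then show "card (group N (block_path n1 n2) PV1V2) = n1"
    "card (group N (block_path n1 n2) PCV2) = n2" "card (group N (block_path n1 n2) PCC) = n3"
    using assms by auto
qed

lemma path_all: "(\<forall>p. Q p) \<longleftrightarrow> Q PCC \<and> Q PCV2 \<and> Q PV1V2"
  by (metis path.exhaust)

lemma sum_card_group: "card (group N Z PV1V2) + card (group N Z PCV2) + card (group N Z PCC) = N"
proof -
  have N: "{..<N} = (group N Z PV1V2 \<union> group N Z PCV2) \<union> group N Z PCC"
    using path.exhaust by (auto simp: group_def)
  have fin: "finite (group N Z p)" for p by (simp add: group_def)
  have "card {..<N} = card (group N Z PV1V2) + card (group N Z PCV2) + card (group N Z PCC)"
    unfolding N by (subst card_Un_disjoint, simp_all add: fin, force simp: group_def)
      (rule card_Un_disjoint, auto simp: fin, auto simp: group_def)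
  then show ?thesis by simp
qed

lemma assignments_eq_perm:
  assumes n: "n1 + n2 + n3 = N"
  shows "assignments N n1 n2 n3 = (\<lambda>\<pi>. block_path n1 n2 \<circ> \<pi>) ` {\<pi>. \<pi> permutes {..<N}}"
proof (intro equalityI subsetI)
  fix Z assume Z: "Z \<in> assignments N n1 n2 n3"
  then have "\<forall>p. card (group N Z p) = card (group N (block_path n1 n2) p)"
    unfolding path_all using card_group_block_path[OF n] by (simp add: assignments_def group_def)
  moreover have "Z i = block_path n1 n2 i" if "i \<ge> N" for i
    using Z that n by (auto simp: assignments_def block_path_def)
  ultimately obtain \<rho> where "\<rho> permutes {..<N}" "Z = block_path n1 n2 \<circ> \<rho>"
    using relabel_permutes[of N Z "block_path n1 n2"] by blast
  then show "Z \<in> (\<lambda>\<pi>. block_path n1 n2 \<circ> \<pi>) ` {\<pi>. \<pi> permutes {..<N}}" by blast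
next
  fix Z assume "Z \<in> (\<lambda>\<pi>. block_path n1 n2 \<circ> \<pi>) ` {\<pi>. \<pi> permutes {..<N}}"
  then obtain \<pi> where \<pi>: "\<pi> permutes {..<N}" "Z = block_path n1 n2 \<circ> \<pi>" by blast
  have "card (group N Z p) = card (group N (block_path n1 n2) p)" for p
    using card_group_comp[OF \<pi>(1)] \<pi>(2) by blast
  moreover have "Z i = PCC" if "i \<ge> N" for i
    using permutes_not_in[OF \<pi>(1), of i] that n \<pi>(2) by (simp add: block_path_def)
  ultimately show "Z \<in> assignments N n1 n2 n3"
    using card_group_block_path[OF n] by (auto simp: assignments_def group_def[symmetric])
qed

lemma design_eq_perm:
  assumes n: "n1 + n2 + n3 = N"
  shows "design N n1 n2 n3 = map_pmf (\<lambda>\<pi>. block_path n1 n2 \<circ> \<pi>) (perm_pmf N)"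
proof -
  define D where "D = map_pmf (\<lambda>\<pi>. block_path n1 n2 \<circ> \<pi>) (perm_pmf N)"
  have set: "set_pmf D = assignments N n1 n2 n3"
    by (simp add: D_def set_perm_pmf assignments_eq_perm[OF n])
  have "pmf D Z = pmf D (block_path n1 n2)" if Z: "Z \<in> set_pmf D" for Z
  proof -
    obtain \<rho> where \<rho>: "\<rho> permutes {..<N}" "Z = block_path n1 n2 \<circ> \<rho>"
      using Z by (auto simp: D_def set_perm_pmf)
    have "map_pmf (\<lambda>Z. Z \<circ> \<rho>) D
        = map_pmf (\<lambda>\<pi>. block_path n1 n2 \<circ> \<pi>) (map_pmf (\<lambda>\<pi>. \<pi> \<circ> \<rho>) (perm_pmf N))"
      by (simp add: D_def pmf.map_comp o_def)
    also have "\<dots> = D" by (simp add: D_def map_perm_pmf_comp(2)[OF \<rho>(1)])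
    finally have "pmf D Z = pmf (map_pmf (\<lambda>Z. Z \<circ> \<rho>) D) (block_path n1 n2 \<circ> \<rho>)"
      using \<rho>(2) by simp
    also have "inj (\<lambda>Z :: nat \<Rightarrow> path. Z \<circ> \<rho>)"
      by (rule inj_on_inverseI[of _ "\<lambda>Z. Z \<circ> inv \<rho>"]) (simp add: o_assoc[symmetric] permutes_inv_o[OF \<rho>(1)])
    then have "pmf (map_pmf (\<lambda>Z. Z \<circ> \<rho>) D) (block_path n1 n2 \<circ> \<rho>) = pmf D (block_path n1 n2)"
      by (rule pmf_map_inj')
    finally show ?thesis .
  qed
  moreover have "finite (set_pmf D)" by (simp add: D_def finite_set_perm_pmf)
  ultimately have "D = pmf_of_set (set_pmf D)" by (rule pmf_eq_pmf_of_set[rotated])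
  then show ?thesis unfolding design_def set by (simp add: D_def)
qed

definition sorted_path :: "nat \<Rightarrow> (nat \<Rightarrow> path) \<Rightarrow> nat \<Rightarrow> path" where
  "sorted_path N z = block_path (card (group N z PV1V2)) (card (group N z PCV2))"

lemma Pi_pmf_eq_sorted_perm:
  "Pi_pmf {..<N} PCC (\<lambda>_. q)
     = map_pmf (\<lambda>(z, \<pi>). sorted_path N z \<circ> \<pi>) (pair_pmf (Pi_pmf {..<N} PCC (\<lambda>_. q)) (perm_pmf N))"
proof -
  let ?Q = "Pi_pmf {..<N} PCC (\<lambda>_. q)"
  have "map_pmf (\<lambda>(z, \<pi>). sorted_path N z \<circ> \<pi>) (pair_pmf ?Q (perm_pmf N))
      = bind_pmf ?Q (\<lambda>z. map_pmf (\<lambda>\<pi>. sorted_path N z \<circ> \<pi>) (perm_pmf N))"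
    by (simp add: pair_pmf_def map_pmf_def bind_assoc_pmf bind_return_pmf)
  also have "\<dots> = bind_pmf ?Q (\<lambda>z. map_pmf (\<lambda>\<pi>. z \<circ> \<pi>) (perm_pmf N))"
  proof (intro bind_pmf_cong refl)
    fix z assume "z \<in> set_pmf ?Q"
    then have z: "z i = PCC" if "i \<ge> N" for i
      using set_Pi_pmf_subset[of "{..<N}" PCC "\<lambda>_. q"] that by auto
    have "\<forall>p. card (group N (sorted_path N z) p) = card (group N z p)"
      unfolding path_all sorted_path_def using card_group_block_path[OF sum_card_group[of N z]] by simp
    moreover have "sorted_path N z i = z i" if "i \<ge> N" for i
      using z[OF that] sum_card_group[of N z] that by (auto simp: sorted_path_def block_path_def)
    ultimately obtain \<rho> where \<rho>: "\<rho> permutes {..<N}" "sorted_path N z = z \<circ> \<rho>"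
      using relabel_permutes[of N "sorted_path N z" z] by blast
    have "map_pmf (\<lambda>\<pi>. sorted_path N z \<circ> \<pi>) (perm_pmf N)
        = map_pmf (\<lambda>\<pi>. z \<circ> \<pi>) (map_pmf (\<lambda>\<pi>. \<rho> \<circ> \<pi>) (perm_pmf N))"
      by (simp add: pmf.map_comp o_def \<rho>(2))
    then show "map_pmf (\<lambda>\<pi>. sorted_path N z \<circ> \<pi>) (perm_pmf N) = map_pmf (\<lambda>\<pi>. z \<circ> \<pi>) (perm_pmf N)"
      by (simp add: map_perm_pmf_comp(1)[OF \<rho>(1)])
  qed
  also have "\<dots> = bind_pmf (perm_pmf N) (\<lambda>\<pi>. map_pmf (\<lambda>z. z \<circ> \<pi>) ?Q)"
    unfolding map_pmf_def by (rule bind_commute_pmf)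
  also have "\<dots> = bind_pmf (perm_pmf N) (\<lambda>\<pi>. ?Q)"
  proof (intro bind_pmf_cong refl)
    fix \<pi> assume "\<pi> \<in> set_pmf (perm_pmf N)"
    then have "\<pi> permutes {..<N}" by (simp add: set_perm_pmf)
    then show "map_pmf (\<lambda>z. z \<circ> \<pi>) ?Q = ?Q"
      by (intro Pi_pmf_bij_betw[symmetric]) (auto simp: permutes_imp_bij permutes_not_in)
  qed
  finally show ?thesis by simp
qed

lemma card_block_path_diff:
  "real (card {k. k < N \<and> block_path n1 n2 k \<noteq> block_path m1 m2 k})
     \<le> \<bar>real n1 - real m1\<bar> + \<bar>real (n1 + n2) - real (m1 + m2)\<bar>"
proof -
  let ?A = "{min n1 m1..<max n1 m1}" and ?B = "{min (n1+n2) (m1+m2)..<max (n1+n2) (m1+m2)}"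
  have "{k. k < N \<and> block_path n1 n2 k \<noteq> block_path m1 m2 k} \<subseteq> ?A \<union> ?B"
    by (auto simp: block_path_def split: if_splits)
  then have "card {k. k < N \<and> block_path n1 n2 k \<noteq> block_path m1 m2 k} \<le> card (?A \<union> ?B)"
    by (intro card_mono) auto
  also have "\<dots> \<le> card ?A + card ?B" by (rule card_Un_le)
  finally have "real (card {k. k < N \<and> block_path n1 n2 k \<noteq> block_path m1 m2 k}) \<le> real (card ?A) + real (card ?B)"
    by linarith
  also have "real (card ?A) = \<bar>real n1 - real m1\<bar>" by (auto simp: min_def max_def)
  also have "real (card ?B) = \<bar>real (n1 + n2) - real (m1 + m2)\<bar>" by (auto simp: min_def max_def)
  finally show ?thesis .
qed

lemma finite_set_Pi_pmf:
  assumes "finite A" "\<And>x. x \<in> A \<Longrightarrow> finite (set_pmf (p x))"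
  shows "finite (set_pmf (Pi_pmf A d p))"
  using assms by (simp add: set_Pi_pmf) (rule finite_PiE_dflt, auto)

lemma expectation_Pi_pmf_sum_square:
  fixes h :: "'i \<Rightarrow> 'a \<Rightarrow> real"
  assumes "finite A" "finite (set_pmf q)"
    and "\<And>i. i \<in> A \<Longrightarrow> measure_pmf.expectation q (h i) = 0"
  shows "measure_pmf.expectation (Pi_pmf A d (\<lambda>_. q)) (\<lambda>z. \<Sum>i\<in>A. h i (z i)) = 0
      \<and> measure_pmf.expectation (Pi_pmf A d (\<lambda>_. q)) (\<lambda>z. (\<Sum>i\<in>A. h i (z i))\<^sup>2)
       = (\<Sum>i\<in>A. measure_pmf.expectation q (\<lambda>x. (h i x)\<^sup>2))"
  using assms(1,3)
proof (induction A rule: finite_induct)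
  case (insert x A)
  let ?Q = "Pi_pmf A d (\<lambda>_. q)"
  have fin: "finite (set_pmf ?Q)" by (rule finite_set_Pi_pmf) (use insert assms(2) in auto)
  have int [simp]: "integrable (measure_pmf ?Q) f" "integrable (measure_pmf q) g" for f g :: "_ \<Rightarrow> real"
    by (rule integrable_measure_pmf_finite; fact)+
  have sum: "(\<Sum>i\<in>insert x A. h i ((f(x := y)) i)) = h x y + (\<Sum>i\<in>A. h i (f i))" for f y
    using insert by (auto intro!: sum.cong)
  have IH: "measure_pmf.expectation ?Q (\<lambda>z. \<Sum>i\<in>A. h i (z i)) = 0"
    "measure_pmf.expectation ?Q (\<lambda>z. (\<Sum>i\<in>A. h i (z i))\<^sup>2)
       = (\<Sum>i\<in>A. measure_pmf.expectation q (\<lambda>x. (h i x)\<^sup>2))"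
    using insert by auto
  have E: "measure_pmf.expectation (Pi_pmf (insert x A) d (\<lambda>_. q)) F
     = measure_pmf.expectation q (\<lambda>y. measure_pmf.expectation ?Q (\<lambda>f. F (f(x := y))))" for F :: "_ \<Rightarrow> real"
    using insert fin assms(2)
    by (simp add: Pi_pmf_insert expectation_pair_pmf_finite case_prod_beta)
  have "measure_pmf.expectation ?Q (\<lambda>f. h x y + (\<Sum>i\<in>A. h i (f i))) = h x y" for y
    using IH(1) by (subst Bochner_Integration.integral_add) (simp_all del: Bochner_Integration.integral_sum)
  moreover have "measure_pmf.expectation ?Q (\<lambda>f. (h x y + (\<Sum>i\<in>A. h i (f i)))\<^sup>2)
      = (h x y)\<^sup>2 + (\<Sum>i\<in>A. measure_pmf.expectation q (\<lambda>x. (h i x)\<^sup>2))" for y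
  proof -
    have "measure_pmf.expectation ?Q (\<lambda>f. (h x y + (\<Sum>i\<in>A. h i (f i)))\<^sup>2)
       = measure_pmf.expectation ?Q (\<lambda>f. ((h x y)\<^sup>2 + (2 * h x y) * (\<Sum>i\<in>A. h i (f i))) + (\<Sum>i\<in>A. h i (f i))\<^sup>2)"
      by (simp add: power2_sum algebra_simps)
    also have "\<dots> = ((h x y)\<^sup>2 + (2 * h x y) * measure_pmf.expectation ?Q (\<lambda>f. \<Sum>i\<in>A. h i (f i)))
        + measure_pmf.expectation ?Q (\<lambda>f. (\<Sum>i\<in>A. h i (f i))\<^sup>2)"
      by (subst Bochner_Integration.integral_add, simp, simp)
        (subst Bochner_Integration.integral_add, simp, simp,
         simp del: Bochner_Integration.integral_sum)
    finally show ?thesis using IH by simp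
  qed
  ultimately show ?case
    unfolding E sum using insert by simp
qed simp

section \<open>Coupling with independent assignments\<close>

lemma finite_set_pmf_path: "finite (set_pmf (q :: path pmf))"
proof (rule finite_subset)
  show "set_pmf q \<subseteq> {PCC, PCV2, PV1V2}" using path.exhaust by blast
qed simp

definition marginal :: "nat \<Rightarrow> nat \<Rightarrow> nat \<Rightarrow> path pmf" where
  "marginal N n1 n2 = map_pmf (block_path n1 n2) (pmf_of_set {..<N})"

definition iid_design :: "nat \<Rightarrow> nat \<Rightarrow> nat \<Rightarrow> (nat \<Rightarrow> path) pmf" where
  "iid_design N n1 n2 = Pi_pmf {..<N} PCC (\<lambda>_. marginal N n1 n2)"

lemma finite_set_iid_design: "finite (set_pmf (iid_design N n1 n2))"
  unfolding iid_design_def by (intro finite_set_Pi_pmf) (auto simp: finite_set_pmf_path)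

lemma expectation_marginal:
  fixes f :: "path \<Rightarrow> real"
  assumes "N > 0"
  shows "measure_pmf.expectation (marginal N n1 n2) f = (\<Sum>k<N. f (block_path n1 n2 k)) / real N"
  using assms by (simp add: marginal_def integral_pmf_of_set lessThan_empty_iff)

lemma expectation_iid_design_count_dev:
  assumes N: "N > 0"
  shows "measure_pmf.expectation (iid_design N n1 n2)
           (\<lambda>z. \<bar>real (card {k. k < N \<and> block_path n1 n2 k \<in> A}) - real (card {i. i < N \<and> z i \<in> A})\<bar>)
         \<le> sqrt (real N)"
proof -
  let ?Q = "iid_design N n1 n2" and ?q = "marginal N n1 n2"
  let ?n = "real (card {k. k < N \<and> block_path n1 n2 k \<in> A})"
  define h :: "nat \<Rightarrow> path \<Rightarrow> real" where "h i p = indicator A p - ?n / real N" for i p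
  have cnt: "(\<Sum>i<N. indicator A (z i)) = real (card {i. i < N \<and> z i \<in> A})" for z :: "nat \<Rightarrow> path"
  proof -
    have "(\<Sum>i<N. indicator A (z i)) = real (card {i \<in> {..<N}. z i \<in> A})"
      by (simp add: indicator_def sum.If_cases of_bool_def) (simp add: Int_def)
    then show ?thesis by simp
  qed
  have "?n \<le> real N" using card_mono[of "{..<N}" "{k. k < N \<and> block_path n1 n2 k \<in> A}"] by auto
  then have c: "0 \<le> ?n / real N" "?n / real N \<le> 1" using N by auto
  have h0: "measure_pmf.expectation ?q (h i) = 0" for i
    using N cnt[of "block_path n1 n2"] by (simp add: expectation_marginal h_def sum_subtractf)
  have "measure_pmf.expectation ?Q (\<lambda>z. (\<Sum>i<N. h i (z i))\<^sup>2)
      = (\<Sum>i<N. measure_pmf.expectation ?q (\<lambda>p. (h i p)\<^sup>2))"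
    using expectation_Pi_pmf_sum_square[of "{..<N}" ?q h PCC] h0
    by (simp add: iid_design_def finite_set_pmf_path)
  also have "\<dots> \<le> (\<Sum>i<N. 1)"
  proof (intro sum_mono)
    fix i
    have "\<bar>h i p\<bar> \<le> 1" for p using c by (auto simp: h_def indicator_def)
    then have "(h i p)\<^sup>2 \<le> 1" for p by (simp add: abs_square_le_1)
    then show "measure_pmf.expectation ?q (\<lambda>p. (h i p)\<^sup>2) \<le> 1"
      using N by (simp add: expectation_marginal divide_le_eq)
        (use sum_bounded_above[of "{..<N}" "\<lambda>k. (h i (block_path n1 n2 k))\<^sup>2" 1] in simp)
  qed
  finally have *: "measure_pmf.expectation ?Q (\<lambda>z. (\<Sum>i<N. h i (z i))\<^sup>2) \<le> real N" by simp
  have "(\<Sum>i<N. h i (z i)) = real (card {i. i < N \<and> z i \<in> A}) - ?n" for z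
    using N cnt[of z] by (simp add: h_def sum_subtractf)
  then have "measure_pmf.expectation ?Q (\<lambda>z. \<bar>?n - real (card {i. i < N \<and> z i \<in> A})\<bar>)
      = measure_pmf.expectation ?Q (\<lambda>z. \<bar>\<Sum>i<N. h i (z i)\<bar>)"
    by (simp add: abs_minus_commute)
  also have "\<dots> \<le> sqrt (measure_pmf.expectation ?Q (\<lambda>z. (\<Sum>i<N. h i (z i))\<^sup>2))"
    by (rule expectation_abs_le_sqrt[OF finite_set_iid_design])
  also have "\<dots> \<le> sqrt (real N)" using * by simp
  finally show ?thesis .
qed

lemma expectation_card_block_path_diff:
  assumes n: "n1 + n2 + n3 = N" and N: "N > 0"
  shows "measure_pmf.expectation (iid_design N n1 n2)
     (\<lambda>z. real (card {k. k < N \<and> block_path n1 n2 k \<noteq> sorted_path N z k})) \<le> 2 * sqrt (real N)"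
proof -
  let ?Q = "iid_design N n1 n2"
  let ?d = "\<lambda>A z. \<bar>real (card {k. k < N \<and> block_path n1 n2 k \<in> A}) - real (card {i. i < N \<and> z i \<in> A})\<bar>"
  have int: "integrable (measure_pmf ?Q) f" for f :: "_ \<Rightarrow> real"
    by (rule integrable_measure_pmf_finite[OF finite_set_iid_design])
  have two: "card {k. k < N \<and> f k \<in> {PV1V2, PCV2}} = card (group N f PV1V2) + card (group N f PCV2)" for f
  proof -
    have "{k. k < N \<and> f k \<in> {PV1V2, PCV2}} = group N f PV1V2 \<union> group N f PCV2"
      by (auto simp: group_def)
    moreover have "card (group N f PV1V2 \<union> group N f PCV2) = card (group N f PV1V2) + card (group N f PCV2)"
      by (rule card_Un_disjoint) (auto simp: group_def)
    ultimately show ?thesis by metis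
  qed
  have "real (card {k. k < N \<and> block_path n1 n2 k \<noteq> sorted_path N z k})
      \<le> ?d {PV1V2} z + ?d {PV1V2, PCV2} z" for z
    using card_block_path_diff[of N n1 n2 "card (group N z PV1V2)" "card (group N z PCV2)"]
      card_group_block_path[OF n] unfolding two sorted_path_def by (simp add: group_def)
  then have "measure_pmf.expectation ?Q
     (\<lambda>z. real (card {k. k < N \<and> block_path n1 n2 k \<noteq> sorted_path N z k}))
     \<le> measure_pmf.expectation ?Q (\<lambda>z. ?d {PV1V2} z + ?d {PV1V2, PCV2} z)"
    by (intro integral_mono int)
  also have "\<dots> = measure_pmf.expectation ?Q (?d {PV1V2}) + measure_pmf.expectation ?Q (?d {PV1V2, PCV2})"
    by (intro Bochner_Integration.integral_add int)
  also have "\<dots> \<le> sqrt (real N) + sqrt (real N)"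
    by (intro add_mono expectation_iid_design_count_dev N)
  finally show ?thesis by simp
qed

lemma design_iid_lipschitz_bound:
  fixes w :: "nat \<Rightarrow> path \<Rightarrow> real" and h :: "real \<Rightarrow> complex"
  assumes n: "n1 + n2 + n3 = N" and N: "N \<ge> 2"
    and w0: "\<And>p. (\<Sum>i<N. w i p) = 0" and wB: "\<And>p. (\<Sum>i<N. (w i p)\<^sup>2) \<le> B"
    and lip: "\<And>x y. norm (h x - h y) \<le> c * \<bar>x - y\<bar>" and c: "c \<ge> 0"
  shows "norm (measure_pmf.expectation (design N n1 n2 n3) (\<lambda>Z. h (\<Sum>i<N. w i (Z i)))
             - measure_pmf.expectation (iid_design N n1 n2) (\<lambda>Z. h (\<Sum>i<N. w i (Z i))))
       \<le> c * sqrt (8 * B * sqrt (real N) / (real N - 1))"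
proof -
  let ?Q = "iid_design N n1 n2" and ?U = "perm_pmf N"
  let ?P = "pair_pmf ?Q ?U"
  define S where "S Z = (\<Sum>i<N. w i (Z i))" for Z
  define m where "m z i k = w i (block_path n1 n2 k) - w i (sorted_path N z k)" for z i k
  define X where "X z \<pi> = (\<Sum>i<N. m z i (\<pi> i))" for z \<pi>
  have X: "X z \<pi> = S (block_path n1 n2 \<circ> \<pi>) - S (sorted_path N z \<circ> \<pi>)" for z \<pi>
    by (simp add: X_def m_def S_def sum_subtractf)
  have finP: "finite (set_pmf ?P)"
    by (simp add: finite_set_iid_design finite_set_perm_pmf)
  have intP: "integrable (measure_pmf ?P) f" for f :: "_ \<Rightarrow> 'b::{banach, second_countable_topology}"
    by (rule integrable_measure_pmf_finite[OF finP])
  have intQ: "integrable (measure_pmf ?Q) f" for f :: "_ \<Rightarrow> real"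
    by (rule integrable_measure_pmf_finite[OF finite_set_iid_design])
  have B0: "B \<ge> 0" using wB[of PCC] sum_nonneg[of "{..<N}" "\<lambda>i. (w i PCC)\<^sup>2"] by simp
  have 1: "measure_pmf.expectation (design N n1 n2 n3) (\<lambda>Z. h (S Z))
      = measure_pmf.expectation ?P (\<lambda>x. h (S (block_path n1 n2 \<circ> snd x)))"
    by (simp add: design_eq_perm[OF n]
        expectation_pair_pmf_snd[of ?Q ?U "\<lambda>\<pi>. h (S (block_path n1 n2 \<circ> \<pi>))"])
  have 2: "measure_pmf.expectation ?Q (\<lambda>Z. h (S Z))
      = measure_pmf.expectation ?P (\<lambda>x. h (S (sorted_path N (fst x) \<circ> snd x)))"
    by (subst iid_design_def, subst Pi_pmf_eq_sorted_perm, simp add: case_prod_beta iid_design_def)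
  have "norm (measure_pmf.expectation (design N n1 n2 n3) (\<lambda>Z. h (S Z)) - measure_pmf.expectation ?Q (\<lambda>Z. h (S Z)))
     = norm (measure_pmf.expectation ?P (\<lambda>x. h (S (block_path n1 n2 \<circ> snd x)) - h (S (sorted_path N (fst x) \<circ> snd x))))"
    unfolding 1 2 by (subst Bochner_Integration.integral_diff) (auto intro: intP)
  also have "\<dots> \<le> measure_pmf.expectation ?P
      (\<lambda>x. norm (h (S (block_path n1 n2 \<circ> snd x)) - h (S (sorted_path N (fst x) \<circ> snd x))))"
    by (rule integral_norm_bound)
  also have "\<dots> \<le> measure_pmf.expectation ?P (\<lambda>x. c * \<bar>X (fst x) (snd x)\<bar>)"
    by (intro integral_mono intP) (unfold X, rule lip)
  also have "\<dots> = c * measure_pmf.expectation ?P (\<lambda>x. \<bar>X (fst x) (snd x)\<bar>)"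
    by simp
  also have "\<dots> \<le> c * sqrt (measure_pmf.expectation ?P (\<lambda>x. (X (fst x) (snd x))\<^sup>2))"
    by (intro mult_left_mono c expectation_abs_le_sqrt finP)
  also have "measure_pmf.expectation ?P (\<lambda>x. (X (fst x) (snd x))\<^sup>2)
     = measure_pmf.expectation ?Q (\<lambda>z. measure_pmf.expectation ?U (\<lambda>\<pi>. (X z \<pi>)\<^sup>2))"
    by (subst expectation_pair_pmf_finite) (auto simp: finite_set_iid_design finite_set_perm_pmf)
  also have "\<dots> \<le> measure_pmf.expectation ?Q (\<lambda>z. 4 * B / (real N - 1) *
        real (card {k. k < N \<and> block_path n1 n2 k \<noteq> sorted_path N z k}))"
  proof (intro integral_mono intQ)
    fix z
    let ?D = "{k. k < N \<and> block_path n1 n2 k \<noteq> sorted_path N z k}"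
    have "measure_pmf.expectation ?U (\<lambda>\<pi>. (X z \<pi>)\<^sup>2) \<le> (\<Sum>i<N. \<Sum>k<N. (m z i k)\<^sup>2) / (real N - 1)"
      unfolding X_def by (rule expectation_perm_sum_square_le[OF N]) (simp add: m_def sum_subtractf w0)
    also have "(\<Sum>i<N. \<Sum>k<N. (m z i k)\<^sup>2) = (\<Sum>k<N. \<Sum>i<N. (m z i k)\<^sup>2)" by (rule sum.swap)
    also have "\<dots> = (\<Sum>k\<in>?D. \<Sum>i<N. (m z i k)\<^sup>2)"
      by (rule sum.mono_neutral_right) (auto simp: m_def)
    also have "\<dots> \<le> (\<Sum>k\<in>?D. 4 * B)"
    proof (rule sum_mono)
      fix k
      have "(m z i k)\<^sup>2 \<le> 2 * (w i (block_path n1 n2 k))\<^sup>2 + 2 * (w i (sorted_path N z k))\<^sup>2" for i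
        using zero_le_power2[of "w i (block_path n1 n2 k) + w i (sorted_path N z k)"]
        unfolding m_def power2_sum power2_diff by linarith
      then have "(\<Sum>i<N. (m z i k)\<^sup>2) \<le> (\<Sum>i<N. 2 * (w i (block_path n1 n2 k))\<^sup>2 + 2 * (w i (sorted_path N z k))\<^sup>2)"
        by (rule sum_mono)
      also have "\<dots> = 2 * (\<Sum>i<N. (w i (block_path n1 n2 k))\<^sup>2) + 2 * (\<Sum>i<N. (w i (sorted_path N z k))\<^sup>2)"
        by (simp add: sum.distrib sum_distrib_left)
      also have "\<dots> \<le> 4 * B" using wB[of "block_path n1 n2 k"] wB[of "sorted_path N z k"] by linarith
      finally show "(\<Sum>i<N. (m z i k)\<^sup>2) \<le> 4 * B" .
    qed
    finally show "measure_pmf.expectation ?U (\<lambda>\<pi>. (X z \<pi>)\<^sup>2) \<le> 4 * B / (real N - 1) * real (card ?D)"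
      using N by (simp add: divide_right_mono mult.commute)
  qed
  also have "\<dots> = 4 * B / (real N - 1) * measure_pmf.expectation ?Q (\<lambda>z.
        real (card {k. k < N \<and> block_path n1 n2 k \<noteq> sorted_path N z k}))"
    by (rule integral_mult_right_zero)
  also have "\<dots> \<le> 4 * B / (real N - 1) * (2 * sqrt (real N))"
    using N B0 by (intro mult_left_mono expectation_card_block_path_diff[OF n]) auto
  also have "\<dots> = 8 * B * sqrt (real N) / (real N - 1)" by simp
  finally show ?thesis unfolding S_def using c by (simp add: mult_left_mono)
qed

section \<open>Central limit theorem for the design\<close>

lemma norm_iexp_diff_le: "norm (iexp x - iexp y) \<le> \<bar>x - y\<bar>"
proof -
  have "iexp x - iexp y = iexp y * (iexp (x - y) - 1)"
    by (simp add: algebra_simps flip: exp_add)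
  then have "norm (iexp x - iexp y) = norm (iexp (x - y) - 1)"
    by (simp add: norm_mult)
  also have "\<dots> \<le> \<bar>x - y\<bar>"
    using iexp_approx1[of "x - y" 0] by simp
  finally show ?thesis .
qed

lemma exp_minus_linear_bound:
  assumes "(x::real) \<ge> 0"
  shows "\<bar>(1 - x) - exp (- x)\<bar> \<le> x\<^sup>2"
proof -
  have "exp (- x) \<le> 1 / (1 + x)"
    using exp_ge_add_one_self[of x] assms by (simp add: exp_minus inverse_eq_divide divide_simps)
  also have "\<dots> \<le> 1 - x + x\<^sup>2"
  proof -
    have "(1 - x + x\<^sup>2) * (1 + x) = 1 + x ^ 3" by algebra
    then show ?thesis using assms by (simp add: divide_le_eq)
  qed
  finally show ?thesis using exp_ge_add_one_self[of "- x"] by (simp add: abs_le_iff)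
qed

lemma iid_char_bound:
  fixes h :: "nat \<Rightarrow> path \<Rightarrow> real"
  assumes h0: "\<And>i. i < N \<Longrightarrow> measure_pmf.expectation q (h i) = 0"
    and M: "\<And>i p. i < N \<Longrightarrow> \<bar>h i p\<bar> \<le> M"
  defines "s \<equiv> (\<Sum>i<N. measure_pmf.expectation q (\<lambda>p. (h i p)\<^sup>2))"
  shows "norm (measure_pmf.expectation (Pi_pmf {..<N} PCC (\<lambda>_. q)) (\<lambda>z. iexp (t * (\<Sum>i<N. h i (z i))))
           - exp (- (t\<^sup>2 * s / 2))) \<le> (\<bar>t\<bar> ^ 3 * M + t ^ 4 * M\<^sup>2) * s"
proof -
  let ?Q = "Pi_pmf {..<N} PCC (\<lambda>_. q)"
  define v where "v i = measure_pmf.expectation q (\<lambda>p. (h i p)\<^sup>2)" for i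
  define X where "X i z = h i (z i)" for i and z :: "nat \<Rightarrow> path"
  have finQ: "finite (set_pmf ?Q)" by (intro finite_set_Pi_pmf) (auto simp: finite_set_pmf_path)
  have intQ [simp]: "integrable (measure_pmf ?Q) f" for f :: "_ \<Rightarrow> real"
    by (rule integrable_measure_pmf_finite[OF finQ])
  have intq [simp]: "integrable (measure_pmf q) f" for f :: "_ \<Rightarrow> real"
    by (rule integrable_measure_pmf_finite[OF finite_set_pmf_path])
  have comp: "measure_pmf.expectation ?Q (\<lambda>z. f (z i)) = measure_pmf.expectation q f" if "i < N" for i and f :: "path \<Rightarrow> real"
  proof -
    have "measure_pmf.expectation ?Q (\<lambda>z. f (z i)) = measure_pmf.expectation (map_pmf (\<lambda>z. z i) ?Q) f"
      by simp
    then show ?thesis using that by (simp add: Pi_pmf_component del: integral_map_pmf)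
  qed
  have v0: "0 \<le> v i" for i unfolding v_def by (rule Bochner_Integration.integral_nonneg) simp
  have vM: "v i \<le> M\<^sup>2" if "i < N" for i
  proof -
    have "(h i p)\<^sup>2 \<le> M\<^sup>2" for p using M[OF that, of p] by (meson abs_ge_zero abs_le_square_iff order_trans power2_le_iff_abs_le)
    then have "v i \<le> measure_pmf.expectation q (\<lambda>_. M\<^sup>2)"
      unfolding v_def by (intro integral_mono) auto
    then show ?thesis by simp
  qed
  have indep: "prob_space.indep_vars (measure_pmf ?Q) (\<lambda>_. borel) X {..<N}"
    unfolding X_def
    by (rule prob_space.indep_vars_compose2[OF measure_pmf.prob_space_axioms indep_vars_Pi_pmf]) auto
  have "measure_pmf.expectation ?Q (\<lambda>z. iexp (t * (\<Sum>i<N. h i (z i))))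
     = char (distr (measure_pmf ?Q) borel (\<lambda>z. \<Sum>i<N. X i z)) t"
    by (simp add: char_def integral_distr X_def)
  also have "\<dots> = (\<Prod>i<N. char (distr (measure_pmf ?Q) borel (X i)) t)"
    by (rule prob_space.char_distr_sum[OF measure_pmf.prob_space_axioms indep])
  finally have 1: "measure_pmf.expectation ?Q (\<lambda>z. iexp (t * (\<Sum>i<N. h i (z i))))
     = (\<Prod>i<N. char (distr (measure_pmf ?Q) borel (X i)) t)" .
  have 2: "(\<Prod>i<N. complex_of_real (exp (- (t\<^sup>2 * v i / 2)))) = complex_of_real (exp (- (t\<^sup>2 * s / 2)))"
  proof -
    have "(\<Prod>i<N. exp (- (t\<^sup>2 * v i / 2))) = exp (\<Sum>i<N. - (t\<^sup>2 * v i / 2))"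
      by (simp add: exp_sum)
    also have "(\<Sum>i<N. - (t\<^sup>2 * v i / 2)) = - (t\<^sup>2 * s / 2)"
      unfolding s_def v_def[symmetric] by (simp add: sum_negf sum_distrib_left sum_divide_distrib)
    finally show ?thesis by (metis of_real_prod)
  qed
  have single: "norm (char (distr (measure_pmf ?Q) borel (X i)) t - complex_of_real (exp (- (t\<^sup>2 * v i / 2))))
      \<le> (\<bar>t\<bar> ^ 3 * M + t ^ 4 * M\<^sup>2) * v i" if i: "i < N" for i
  proof -
    have M0: "M \<ge> 0" using M[OF i, of PCC] by linarith
    have EX: "measure_pmf.expectation ?Q (X i) = 0"
      unfolding X_def using comp[OF i, of "h i"] h0[OF i] by simp
    have EX2: "measure_pmf.expectation ?Q (\<lambda>z. (X i z)\<^sup>2) = v i"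
      unfolding X_def v_def using comp[OF i, of "\<lambda>p. (h i p)\<^sup>2"] by simp
    have "norm (char (distr (measure_pmf ?Q) borel (X i)) t - (1 - t\<^sup>2 * v i / 2))
       \<le> (t\<^sup>2 / 6) * measure_pmf.expectation ?Q (\<lambda>z. min (6 * (X i z)\<^sup>2) (\<bar>t\<bar> * \<bar>X i z\<bar> ^ 3))"
      by (rule prob_space.char_approx3'[OF measure_pmf.prob_space_axioms, where X = "X i"]) (use EX EX2 in auto)
    also have "\<dots> \<le> (t\<^sup>2 / 6) * measure_pmf.expectation ?Q (\<lambda>z. \<bar>t\<bar> * M * (X i z)\<^sup>2)"
    proof (intro mult_left_mono integral_mono intQ)
      fix z
      have "\<bar>X i z\<bar> * (X i z)\<^sup>2 \<le> M * (X i z)\<^sup>2"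
        unfolding X_def using M[OF i] by (intro mult_right_mono) auto
      then have "\<bar>X i z\<bar> ^ 3 \<le> M * (X i z)\<^sup>2"
        by (simp add: power3_eq_cube power2_eq_square mult.assoc flip: abs_mult)
      then have "\<bar>t\<bar> * \<bar>X i z\<bar> ^ 3 \<le> \<bar>t\<bar> * (M * (X i z)\<^sup>2)"
        by (intro mult_left_mono) auto
      then show "min (6 * (X i z)\<^sup>2) (\<bar>t\<bar> * \<bar>X i z\<bar> ^ 3) \<le> \<bar>t\<bar> * M * (X i z)\<^sup>2"
        by (simp add: mult.assoc min.coboundedI2)
    qed auto
    also have "\<dots> = (\<bar>t\<bar> ^ 3 * M / 6) * v i"
      using EX2 by (simp add: power3_eq_cube power2_eq_square)
    also have "\<dots> \<le> \<bar>t\<bar> ^ 3 * M * v i"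
      using M0 v0[of i] by (intro mult_right_mono) auto
    finally have a: "norm (char (distr (measure_pmf ?Q) borel (X i)) t - (1 - t\<^sup>2 * v i / 2)) \<le> \<bar>t\<bar> ^ 3 * M * v i"
      by simp
    have "norm (complex_of_real (1 - t\<^sup>2 * v i / 2) - complex_of_real (exp (- (t\<^sup>2 * v i / 2))))
       = \<bar>(1 - t\<^sup>2 * v i / 2) - exp (- (t\<^sup>2 * v i / 2))\<bar>"
      by (metis norm_of_real of_real_diff real_norm_def)
    also have "\<dots> \<le> (t\<^sup>2 * v i / 2)\<^sup>2"
      by (rule exp_minus_linear_bound) (use v0[of i] in simp)
    also have "\<dots> = t ^ 4 / 4 * v i * v i" by (simp add: power2_eq_square power4_eq_xxxx)
    also have "\<dots> \<le> t ^ 4 * M\<^sup>2 * v i"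
    proof -
      have "t ^ 4 / 4 * v i \<le> t ^ 4 * M\<^sup>2"
        using vM[OF i] v0[of i] by (intro mult_mono) auto
      then show ?thesis using v0[of i] by (intro mult_right_mono)
    qed
    finally have b: "norm (complex_of_real (1 - t\<^sup>2 * v i / 2) - complex_of_real (exp (- (t\<^sup>2 * v i / 2)))) \<le> t ^ 4 * M\<^sup>2 * v i" .
    have "norm (char (distr (measure_pmf ?Q) borel (X i)) t - complex_of_real (exp (- (t\<^sup>2 * v i / 2))))
       \<le> norm (char (distr (measure_pmf ?Q) borel (X i)) t - (1 - t\<^sup>2 * v i / 2))
        + norm (complex_of_real (1 - t\<^sup>2 * v i / 2) - complex_of_real (exp (- (t\<^sup>2 * v i / 2))))"
      by (rule order_trans[OF _ norm_triangle_ineq]) simp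
    with a b show ?thesis unfolding distrib_right by linarith
  qed
  have "norm ((\<Prod>i<N. char (distr (measure_pmf ?Q) borel (X i)) t) - (\<Prod>i<N. complex_of_real (exp (- (t\<^sup>2 * v i / 2)))))
     \<le> (\<Sum>i<N. norm (char (distr (measure_pmf ?Q) borel (X i)) t - complex_of_real (exp (- (t\<^sup>2 * v i / 2)))))"
  proof (rule norm_prod_diff)
    show "norm (char (distr (measure_pmf ?Q) borel (X i)) t) \<le> 1" for i
      by (rule real_distribution.cmod_char_le_1) (simp add: prob_space.real_distribution_distr[OF measure_pmf.prob_space_axioms])
    show "norm (complex_of_real (exp (- (t\<^sup>2 * v i / 2)))) \<le> 1" for i
      using v0[of i] by simp
  qed
  also have "\<dots> \<le> (\<Sum>i<N. (\<bar>t\<bar> ^ 3 * M + t ^ 4 * M\<^sup>2) * v i)"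
    by (intro sum_mono single) auto
  also have "\<dots> = (\<bar>t\<bar> ^ 3 * M + t ^ 4 * M\<^sup>2) * s"
    unfolding s_def v_def[symmetric] by (simp add: sum_distrib_left)
  finally show ?thesis unfolding 1 2 .
qed

lemma design_sum_square:
  fixes w :: "nat \<Rightarrow> path \<Rightarrow> real"
  assumes n: "n1 + n2 + n3 = N" and N: "N \<ge> 2" and w0: "\<And>p. (\<Sum>i<N. w i p) = 0"
  shows "measure_pmf.expectation (design N n1 n2 n3) (\<lambda>Z. (\<Sum>i<N. w i (Z i))\<^sup>2)
     = real N / (real N - 1) * (\<Sum>i<N. measure_pmf.variance (marginal N n1 n2) (w i))"
proof -
  let ?b = "block_path n1 n2"
  let ?q = "marginal N n1 n2"
  have intq: "integrable (measure_pmf ?q) f" for f :: "_ \<Rightarrow> real"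
    by (rule integrable_measure_pmf_finite[OF finite_set_pmf_path])
  have N0: "real N > 0" "N > 0" "real N - 1 > 0" using N by simp_all
  have "measure_pmf.expectation (design N n1 n2 n3) (\<lambda>Z. (\<Sum>i<N. w i (Z i))\<^sup>2)
     = measure_pmf.expectation (perm_pmf N) (\<lambda>\<pi>. (\<Sum>i<N. w i (?b (\<pi> i)))\<^sup>2)"
    by (simp add: design_eq_perm[OF n])
  also have "\<dots> = ((\<Sum>i<N. \<Sum>k<N. (w i (?b k))\<^sup>2) - (\<Sum>i<N. (\<Sum>k<N. w i (?b k))\<^sup>2) / real N) / (real N - 1)"
    by (rule expectation_perm_sum_square[OF N, of "\<lambda>i k. w i (?b k)"]) (rule w0)
  also have "\<dots> = real N / (real N - 1) * (\<Sum>i<N. (\<Sum>k<N. (w i (?b k))\<^sup>2) / real N - ((\<Sum>k<N. w i (?b k)) / real N)\<^sup>2)"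
  proof -
    have split: "(\<Sum>i<N. (\<Sum>k<N. (w i (?b k))\<^sup>2) / real N - ((\<Sum>k<N. w i (?b k)) / real N)\<^sup>2)
      = (\<Sum>i<N. \<Sum>k<N. (w i (?b k))\<^sup>2) / real N - (\<Sum>i<N. (\<Sum>k<N. w i (?b k))\<^sup>2) / (real N)\<^sup>2"
      by (simp add: sum_subtractf power_divide flip: sum_divide_distrib)
    have "(x - y / n) / m = n / m * (x / n - y / n\<^sup>2)" if "n > 0" "m > 0" for x y n m :: real
      using that by (simp add: field_simps power2_eq_square)
    from this[OF N0(1,3)] show ?thesis unfolding split .
  qed
  also have "\<dots> = real N / (real N - 1) * (\<Sum>i<N. measure_pmf.variance ?q (w i))"
    unfolding measure_pmf.variance_eq[OF intq intq] unfolding expectation_marginal[OF N0(2)] ..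
  finally show ?thesis .
qed

lemma design_char_bound:
  fixes w :: "nat \<Rightarrow> path \<Rightarrow> real"
  assumes n: "n1 + n2 + n3 = N" and N: "N \<ge> 2"
    and w0: "\<And>p. (\<Sum>i<N. w i p) = 0" and wB: "\<And>p. (\<Sum>i<N. (w i p)\<^sup>2) \<le> B"
    and wM: "\<And>i p. i < N \<Longrightarrow> \<bar>w i p\<bar> \<le> M"
  defines "s \<equiv> (real N - 1) / real N * measure_pmf.expectation (design N n1 n2 n3) (\<lambda>Z. (\<Sum>i<N. w i (Z i))\<^sup>2)"
  shows "norm (measure_pmf.expectation (design N n1 n2 n3) (\<lambda>Z. iexp (t * (\<Sum>i<N. w i (Z i)))) - exp (- (t\<^sup>2 * s / 2)))
     \<le> \<bar>t\<bar> * sqrt (8 * B * sqrt (real N) / (real N - 1)) + (\<bar>t\<bar> ^ 3 * (2 * M) + t ^ 4 * (2 * M)\<^sup>2) * s"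
proof -
  let ?q = "marginal N n1 n2" and ?D = "design N n1 n2 n3" and ?Q = "iid_design N n1 n2"
  let ?S = "\<lambda>Z. \<Sum>i<N. w i (Z i)"
  have N0: "real N > 0" "N > 0" "real N - 1 > 0" using N by simp_all
  have intq: "integrable (measure_pmf ?q) f" for f :: "_ \<Rightarrow> real"
    by (rule integrable_measure_pmf_finite[OF finite_set_pmf_path])
  define \<mu> where "\<mu> i = measure_pmf.expectation ?q (w i)" for i
  define h where "h i p = w i p - \<mu> i" for i p
  have s: "s = (\<Sum>i<N. measure_pmf.expectation ?q (\<lambda>p. (h i p)\<^sup>2))"
    using N0 unfolding s_def by (subst design_sum_square[OF n N w0]) (simp add: h_def \<mu>_def)
  have "(\<Sum>i<N. \<mu> i) = (\<Sum>k<N. \<Sum>i<N. w i (block_path n1 n2 k)) / real N"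
    unfolding \<mu>_def expectation_marginal[OF N0(2)] sum_divide_distrib by (rule sum.swap)
  then have \<mu>0: "(\<Sum>i<N. \<mu> i) = 0" by (simp add: w0)
  have hS: "(\<Sum>i<N. h i (z i)) = ?S z" for z
    by (simp add: h_def sum_subtractf \<mu>0)
  have \<mu>M: "\<bar>\<mu> i\<bar> \<le> M" if "i < N" for i
  proof -
    have "\<bar>\<mu> i\<bar> \<le> measure_pmf.expectation ?q (\<lambda>p. \<bar>w i p\<bar>)"
      unfolding \<mu>_def by (rule integral_abs_bound)
    also have "\<dots> \<le> measure_pmf.expectation ?q (\<lambda>p. M)"
      by (intro integral_mono intq wM that)
    finally show ?thesis by simp
  qed
  have 1: "norm (measure_pmf.expectation ?Q (\<lambda>z. iexp (t * ?S z)) - exp (- (t\<^sup>2 * s / 2)))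
     \<le> (\<bar>t\<bar> ^ 3 * (2 * M) + t ^ 4 * (2 * M)\<^sup>2) * s"
  proof -
    have "measure_pmf.expectation ?q (h i) = 0" for i
      unfolding h_def by (subst Bochner_Integration.integral_diff) (auto simp: intq \<mu>_def)
    moreover have "\<bar>h i p\<bar> \<le> 2 * M" if "i < N" for i p
      using wM[OF that, of p] \<mu>M[OF that] unfolding h_def by linarith
    ultimately show ?thesis
      using iid_char_bound[of N ?q h "2 * M" t] unfolding s iid_design_def hS by simp
  qed
  have 2: "norm (measure_pmf.expectation ?D (\<lambda>z. iexp (t * ?S z)) - measure_pmf.expectation ?Q (\<lambda>z. iexp (t * ?S z)))
     \<le> \<bar>t\<bar> * sqrt (8 * B * sqrt (real N) / (real N - 1))"
  proof (rule design_iid_lipschitz_bound[OF n N w0 wB])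
    show "cmod (iexp (t * x) - iexp (t * y)) \<le> \<bar>t\<bar> * \<bar>x - y\<bar>" for x y
      using norm_iexp_diff_le[of "t * x" "t * y"] by (simp add: abs_mult flip: right_diff_distrib)
  qed simp
  have "norm (measure_pmf.expectation ?D (\<lambda>z. iexp (t * ?S z)) - exp (- (t\<^sup>2 * s / 2)))
    \<le> norm (measure_pmf.expectation ?D (\<lambda>z. iexp (t * ?S z)) - measure_pmf.expectation ?Q (\<lambda>z. iexp (t * ?S z)))
     + norm (measure_pmf.expectation ?Q (\<lambda>z. iexp (t * ?S z)) - exp (- (t\<^sup>2 * s / 2)))"
    by (rule order_trans[OF _ norm_triangle_ineq]) simp
  with 1 2 show ?thesis by linarith
qed

lemma design_clt:
  fixes w :: "nat \<Rightarrow> nat \<Rightarrow> path \<Rightarrow> real"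
  assumes n: "\<forall>\<^sub>F N in sequentially. n1 N + n2 N + n3 N = N"
    and w0: "\<And>N p. (\<Sum>i<N. w N i p) = 0"
    and wB: "\<forall>\<^sub>F N in sequentially. \<forall>p. (\<Sum>i<N. (w N i p)\<^sup>2) \<le> B"
    and wM: "\<forall>\<^sub>F N in sequentially. \<forall>i<N. \<forall>p. \<bar>w N i p\<bar> \<le> M N" and M: "M \<longlonglongrightarrow> 0"
    and var: "(\<lambda>N. measure_pmf.expectation (design N (n1 N) (n2 N) (n3 N)) (\<lambda>Z. (\<Sum>i<N. w N i (Z i))\<^sup>2)) \<longlonglongrightarrow> 1"
  shows "weak_conv_m (\<lambda>N. distr (measure_pmf (design N (n1 N) (n2 N) (n3 N))) borel (\<lambda>Z. \<Sum>i<N. w N i (Z i)))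
     std_normal_distribution"
proof (rule levy_continuity)
  fix t :: real
  let ?D = "\<lambda>N. design N (n1 N) (n2 N) (n3 N)"
  let ?S = "\<lambda>N Z. \<Sum>i<N. w N i (Z i)"
  define s where "s N = (real N - 1) / real N * measure_pmf.expectation (?D N) (\<lambda>Z. (?S N Z)\<^sup>2)" for N
  define \<epsilon> where "\<epsilon> N = \<bar>t\<bar> * sqrt (8 * B * sqrt (real N) / (real N - 1)) + (\<bar>t\<bar> ^ 3 * (2 * M N) + t ^ 4 * (2 * M N)\<^sup>2) * s N" for N
  have "(\<lambda>N. (real N - 1) / real N) \<longlonglongrightarrow> 1" by real_asymp
  from tendsto_mult[OF this var] have s: "s \<longlonglongrightarrow> 1" by (simp add: s_def[abs_def])
  have "(\<lambda>N. sqrt (real N) / (real N - 1)) \<longlonglongrightarrow> 0" by real_asymp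
  then have "(\<lambda>N. 8 * B * (sqrt (real N) / (real N - 1))) \<longlonglongrightarrow> 8 * B * 0"
    by (intro tendsto_intros)
  then have r: "(\<lambda>N. sqrt (8 * B * sqrt (real N) / (real N - 1))) \<longlonglongrightarrow> sqrt 0"
    by (intro tendsto_real_sqrt) simp
  have "\<epsilon> \<longlonglongrightarrow> \<bar>t\<bar> * sqrt 0 + (\<bar>t\<bar> ^ 3 * (2 * 0) + t ^ 4 * (2 * 0)\<^sup>2) * 1"
    unfolding \<epsilon>_def by (intro tendsto_add tendsto_mult tendsto_power tendsto_const r s M)
  then have \<epsilon>: "\<epsilon> \<longlonglongrightarrow> 0" by simp
  have "\<forall>\<^sub>F N in sequentially. norm (char (distr (measure_pmf (?D N)) borel (?S N)) t
       - complex_of_real (exp (- (t\<^sup>2 * s N / 2)))) \<le> \<epsilon> N"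
    using n wB wM eventually_ge_at_top[of 2]
  proof eventually_elim
    case (elim N)
    then show ?case
      using design_char_bound[of "n1 N" "n2 N" "n3 N" N "w N" B "M N" t] w0
      by (simp add: char_def integral_distr s_def \<epsilon>_def)
  qed
  from Lim_null_comparison[OF this \<epsilon>]
  have "(\<lambda>N. char (distr (measure_pmf (?D N)) borel (?S N)) t - complex_of_real (exp (- (t\<^sup>2 * s N / 2)))) \<longlonglongrightarrow> 0" .
  moreover have "(\<lambda>N. complex_of_real (exp (- (t\<^sup>2 * s N / 2)))) \<longlonglongrightarrow> complex_of_real (exp (- (t\<^sup>2 * 1 / 2)))"
    by (intro tendsto_intros s) auto
  ultimately have "(\<lambda>N. char (distr (measure_pmf (?D N)) borel (?S N)) t) \<longlonglongrightarrow> complex_of_real (exp (- (t\<^sup>2 * 1 / 2)))"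
    by (rule Lim_transform[rotated])
  then show "(\<lambda>N. char (distr (measure_pmf (?D N)) borel (?S N)) t) \<longlonglongrightarrow> char std_normal_distribution t"
    by (simp add: char_std_normal_distribution)
qed (auto intro!: real_dist_normal_dist prob_space.real_distribution_distr[OF measure_pmf.prob_space_axioms])

section \<open>Standard normal distribution function\<close>

lemma Phi_eq_cdf: "Phi x = cdf std_normal_distribution x"
proof -
  interpret real_distribution std_normal_distribution by (rule real_dist_normal_dist)
  have "cdf std_normal_distribution x = (LINT t|std_normal_distribution. indicator {..x} t)"
    by (simp add: cdf_def)
  also have "\<dots> = Phi x"
    by (subst integral_density) (auto simp: Phi_def set_lebesgue_integral_def mult.commute)
  finally show ?thesis by simp
qed

lemma std_normal_null_iff:
  assumes "A \<in> sets borel"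
  shows "measure std_normal_distribution A = 0 \<longleftrightarrow> emeasure lborel A = 0"
proof -
  interpret real_distribution std_normal_distribution by (rule real_dist_normal_dist)
  have pos: "ennreal (std_normal_density x) \<noteq> 0" for x
    using normal_density_pos[of 1 0 x] by simp
  have "measure std_normal_distribution A = 0 \<longleftrightarrow> emeasure std_normal_distribution A = 0"
    by (simp add: emeasure_eq_measure)
  also have "\<dots> \<longleftrightarrow> A \<in> null_sets std_normal_distribution"
    using assms by (simp add: null_sets_def)
  also have "\<dots> \<longleftrightarrow> (AE x in lborel. x \<notin> A)"
    using assms pos by (subst null_sets_density_iff) auto
  also have "\<dots> \<longleftrightarrow> emeasure lborel A = 0"
    using assms by (subst AE_iff_null) (auto simp: null_sets_def)
  finally show ?thesis .
qed

lemma isCont_Phi: "isCont Phi x"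
proof -
  interpret real_distribution std_normal_distribution by (rule real_dist_normal_dist)
  have "Phi = cdf std_normal_distribution" by (rule ext) (rule Phi_eq_cdf)
  moreover have "prob {x} = 0" by (subst std_normal_null_iff) auto
  ultimately show ?thesis using isCont_cdf by metis
qed

lemma Phi_strict_mono: "strict_mono Phi"
proof (rule strict_monoI)
  fix x y :: real assume xy: "x < y"
  interpret real_distribution std_normal_distribution by (rule real_dist_normal_dist)
  have "measure std_normal_distribution {x<..y} \<noteq> 0"
    using xy by (subst std_normal_null_iff) auto
  moreover have "Phi y - Phi x = measure std_normal_distribution {x<..y}"
    unfolding Phi_eq_cdf using cdf_diff_eq[OF xy] by simp
  ultimately show "Phi x < Phi y" using measure_nonneg[of std_normal_distribution "{x<..y}"] by linarith
qed

lemma Phi_minus: "Phi (- x) = 1 - Phi x"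
proof -
  interpret real_distribution std_normal_distribution by (rule real_dist_normal_dist)
  have "Phi (- x) = (LINT t|lborel. indicator {..- x} t *\<^sub>R std_normal_density t)"
    by (simp add: Phi_def set_lebesgue_integral_def)
  also have "\<dots> = (LINT t|lborel. indicator {..- x} (- t) *\<^sub>R std_normal_density (- t))"
    using lborel_integral_real_affine[of "-1" "\<lambda>t. indicator {..- x} t *\<^sub>R std_normal_density t" 0] by simp
  also have "\<dots> = (LINT t|lborel. std_normal_density t *\<^sub>R indicator {x..} t)"
    by (intro Bochner_Integration.integral_cong) (auto simp: normal_density_def indicator_def)
  also have "\<dots> = (LINT t|std_normal_distribution. indicator {x..} t)"
    by (subst integral_density) auto
  also have "\<dots> = prob {x..}" by simp
  also have "\<dots> = prob ({x<..} \<union> {x})" by (rule arg_cong[of _ _ prob]) auto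
  also have "\<dots> = prob {x<..} + prob {x}" by (intro finite_measure_Union) auto
  also have "prob {x} = 0" by (subst std_normal_null_iff) auto
  also have "prob {x<..} = prob (space std_normal_distribution - {..x})"
    by (rule arg_cong[of _ _ prob]) auto
  also have "\<dots> = 1 - Phi x" by (subst prob_compl) (auto simp: Phi_eq_cdf cdf_def)
  finally show ?thesis by simp
qed

lemma Phi_normal_quantile:
  assumes "0 < p" "p < 1"
  shows "Phi (normal_quantile p) = p"
proof -
  interpret real_distribution std_normal_distribution by (rule real_dist_normal_dist)
  have Phi: "Phi = cdf std_normal_distribution" by (rule ext) (rule Phi_eq_cdf)
  have "\<forall>\<^sub>F x in at_top. p < Phi x"
    unfolding Phi using cdf_lim_at_top_prob assms(2) by (rule order_tendstoD)
  then obtain b where b: "p < Phi b" by (auto simp: eventually_at_top_linorder)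
  have "\<forall>\<^sub>F x in at_bot. Phi x < p"
    unfolding Phi using cdf_lim_at_bot assms(1) by (rule order_tendstoD)
  then obtain a where a: "Phi a < p" by (auto simp: eventually_at_bot_linorder)
  have "a \<le> b" using a b Phi_strict_mono
    by (metis less_trans linear not_less strict_mono_less_eq)
  then obtain z where z: "Phi z = p"
    using IVT[of Phi a p b] a b isCont_Phi by auto
  have "(THE z. Phi z = p) = z"
    by (rule the_equality) (use z Phi_strict_mono in \<open>auto simp: strict_mono_eq\<close>)
  then show ?thesis using z by (simp add: normal_quantile_def)
qed

lemma normal_quantile_pos:
  assumes "1 / 2 < p" "p < 1"
  shows "0 < normal_quantile p"
proof -
  have "Phi 0 = 1 / 2" using Phi_minus[of 0] by simp
  then have "Phi 0 < Phi (normal_quantile p)" using assms by (simp add: Phi_normal_quantile)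
  then show ?thesis using Phi_strict_mono by (simp add: strict_mono_less)
qed

lemma weak_conv_std_normal_two_sided:
  fixes D :: "nat \<Rightarrow> 'a pmf"
  assumes "weak_conv_m (\<lambda>N. distr (measure_pmf (D N)) borel (W N)) std_normal_distribution"
    and x: "x > 0"
  shows "(\<lambda>N. measure_pmf.prob (D N) {Z. - x < W N Z \<and> W N Z \<le> x}) \<longlonglongrightarrow> 2 * Phi x - 1"
proof -
  have cdf: "cdf (distr (measure_pmf (D N)) borel (W N)) y = measure_pmf.prob (D N) {Z. W N Z \<le> y}" for N y
    by (simp add: cdf_def measure_distr vimage_def)
  have lim: "(\<lambda>N. measure_pmf.prob (D N) {Z. W N Z \<le> y}) \<longlonglongrightarrow> Phi y" for y
    using assms(1) isCont_Phi[of y] unfolding weak_conv_m_def weak_conv_def cdf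
    by (simp add: Phi_eq_cdf[abs_def])
  have "measure_pmf.prob (D N) {Z. - x < W N Z \<and> W N Z \<le> x}
     = measure_pmf.prob (D N) {Z. W N Z \<le> x} - measure_pmf.prob (D N) {Z. W N Z \<le> - x}" for N
  proof -
    have "measure_pmf.prob (D N) ({Z. W N Z \<le> x} - {Z. W N Z \<le> - x})
      = measure_pmf.prob (D N) {Z. W N Z \<le> x} - measure_pmf.prob (D N) {Z. W N Z \<le> - x}"
      by (rule measure_pmf.finite_measure_Diff) (use x in auto)
    also have "{Z. W N Z \<le> x} - {Z. W N Z \<le> - x} = {Z. - x < W N Z \<and> W N Z \<le> x}" by auto
    finally show ?thesis .
  qed
  then show ?thesis
    using tendsto_diff[OF lim[of x] lim[of "- x"]] by (simp add: Phi_minus)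
qed

section \<open>Variance estimation\<close>

lemma UNIV_path: "(UNIV :: path set) = {PCC, PCV2, PV1V2}"
  using path.exhaust by blast

lemma finite_UNIV_path: "finite (UNIV :: path set)"
  by (simp add: UNIV_path)

lemma sum_by_group:
  fixes f :: "nat \<Rightarrow> path \<Rightarrow> real"
  shows "(\<Sum>i<N. f i (Z i)) = (\<Sum>p\<in>UNIV. \<Sum>i\<in>group N Z p. f i p)"
proof -
  have "(\<Sum>p\<in>UNIV. \<Sum>i\<in>group N Z p. f i p) = (\<Sum>p\<in>UNIV. \<Sum>i\<in>{i \<in> {..<N}. Z i = p}. f i (Z i))"
    by (intro sum.cong) (auto simp: group_def)
  also have "\<dots> = (\<Sum>i<N. f i (Z i))"
    by (rule sum.group) (auto simp: finite_UNIV_path)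
  finally show ?thesis by simp
qed

abbreviation swd :: "nat \<Rightarrow> (path \<Rightarrow> nat) \<Rightarrow> (nat \<Rightarrow> path) pmf" where
  "swd N n \<equiv> design N (n PV1V2) (n PCV2) (n PCC)"

lemma card_group_block_path':
  assumes "n PV1V2 + n PCV2 + n PCC = N"
  shows "card (group N (block_path (n PV1V2) (n PCV2)) p) = n p"
  using card_group_block_path[OF assms] by (cases p) auto

lemma set_pmf_swd:
  assumes "n PV1V2 + n PCV2 + n PCC = N" "Z \<in> set_pmf (swd N n)"
  shows "card (group N Z p) = n p"
proof -
  obtain \<pi> where "\<pi> permutes {..<N}" "Z = block_path (n PV1V2) (n PCV2) \<circ> \<pi>"
    using assms(2) by (auto simp: design_eq_perm[OF assms(1)] set_perm_pmf)
  then show ?thesis using card_group_comp card_group_block_path'[of n N p, OF assms(1)] by metis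
qed

lemma integrable_swd:
  fixes f :: "_ \<Rightarrow> real"
  assumes "n PV1V2 + n PCV2 + n PCC = N"
  shows "integrable (measure_pmf (swd N n)) f"
  by (rule integrable_measure_pmf_finite) (simp add: design_eq_perm[OF assms] finite_set_perm_pmf)

lemma swd_sum_mean_zero:
  fixes w :: "nat \<Rightarrow> path \<Rightarrow> real"
  assumes n: "n PV1V2 + n PCV2 + n PCC = N" and w0: "\<And>p. (\<Sum>i<N. w i p) = 0"
  shows "measure_pmf.expectation (swd N n) (\<lambda>Z. \<Sum>i<N. w i (Z i)) = 0"
  using expectation_perm_sum[of N "\<lambda>i k. w i (block_path (n PV1V2) (n PCV2) k)"] w0
  by (simp add: design_eq_perm[OF n])

lemma swd_sum_square_le:
  fixes w :: "nat \<Rightarrow> path \<Rightarrow> real"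
  assumes n: "n PV1V2 + n PCV2 + n PCC = N" and N: "N \<ge> 2" and w0: "\<And>p. (\<Sum>i<N. w i p) = 0"
  shows "measure_pmf.expectation (swd N n) (\<lambda>Z. (\<Sum>i<N. w i (Z i))\<^sup>2)
     \<le> (\<Sum>p\<in>UNIV. real (n p) * (\<Sum>i<N. (w i p)\<^sup>2)) / (real N - 1)"
proof -
  let ?b = "block_path (n PV1V2) (n PCV2)"
  have "measure_pmf.expectation (swd N n) (\<lambda>Z. (\<Sum>i<N. w i (Z i))\<^sup>2)
      \<le> (\<Sum>i<N. \<Sum>k<N. (w i (?b k))\<^sup>2) / (real N - 1)"
    using expectation_perm_sum_square_le[OF N, of "\<lambda>i k. w i (?b k)"] w0
    by (simp add: design_eq_perm[OF n])
  also have "(\<Sum>i<N. \<Sum>k<N. (w i (?b k))\<^sup>2) = (\<Sum>k<N. \<Sum>i<N. (w i (?b k))\<^sup>2)"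
    by (rule sum.swap)
  also have "\<dots> = (\<Sum>p\<in>UNIV. real (n p) * (\<Sum>i<N. (w i p)\<^sup>2))"
    using sum_by_group[of "\<lambda>k p. \<Sum>i<N. (w i p)\<^sup>2" ?b N] by (simp add: card_group_block_path'[OF n])
  finally show ?thesis .
qed

lemma group_mean_square_le:
  fixes g :: "nat \<Rightarrow> real"
  assumes n: "n PV1V2 + n PCV2 + n PCC = N" and N: "N \<ge> 2" and g0: "(\<Sum>i<N. g i) = 0"
  shows "measure_pmf.expectation (swd N n) (\<lambda>Z. ((\<Sum>i\<in>group N Z p. g i) / real (n p))\<^sup>2)
     \<le> (\<Sum>i<N. (g i)\<^sup>2) / ((real N - 1) * real (n p))"
proof (cases "n p = 0")
  case False
  define w where "w i p' = (if p' = p then g i / real (n p) else 0)" for i p'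
  have "(\<Sum>i<N. w i (Z i)) = (\<Sum>i\<in>group N Z p. g i) / real (n p)" for Z
  proof -
    have "(\<Sum>i\<in>group N Z p. g i) / real (n p) = (\<Sum>i\<in>{i \<in> {..<N}. Z i = p}. g i / real (n p))"
      by (simp add: group_def sum_divide_distrib)
    also have "\<dots> = (\<Sum>i<N. w i (Z i))"
      unfolding w_def by (rule sum.inter_filter) simp
    finally show ?thesis by simp
  qed
  moreover have "(\<Sum>i<N. w i p') = 0" for p'
    using g0 by (cases "p' = p") (simp_all add: w_def flip: sum_divide_distrib)
  moreover have "(\<Sum>p'\<in>UNIV. real (n p') * (\<Sum>i<N. (w i p')\<^sup>2)) = (\<Sum>i<N. (g i)\<^sup>2) / real (n p)"
  proof -
    have "(\<Sum>p'\<in>UNIV. real (n p') * (\<Sum>i<N. (w i p')\<^sup>2))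
       = (\<Sum>p'\<in>UNIV. if p' = p then real (n p) * (\<Sum>i<N. (g i / real (n p))\<^sup>2) else 0)"
      by (intro sum.cong) (auto simp: w_def)
    also have "\<dots> = real (n p) * (\<Sum>i<N. (g i / real (n p))\<^sup>2)"
      by (simp add: finite_UNIV_path)
    also have "(\<Sum>i<N. (g i / real (n p))\<^sup>2) = (\<Sum>i<N. (g i)\<^sup>2) / (real (n p))\<^sup>2"
      by (simp add: power_divide sum_divide_distrib)
    finally show ?thesis using False by (simp add: power2_eq_square)
  qed
  ultimately show ?thesis
    using swd_sum_square_le[OF n N, of w] by (simp add: mult.commute)
qed simp

lemma group_second_moment_L1:
  fixes y :: "nat \<Rightarrow> real"
  assumes n: "n PV1V2 + n PCV2 + n PCC = N" and N: "N \<ge> 2" and np: "0 < n p"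
    and y0: "(\<Sum>i<N. y i) = 0" and K: "\<And>i. i < N \<Longrightarrow> (y i)\<^sup>2 \<le> K"
  defines "v \<equiv> (\<Sum>i<N. (y i)\<^sup>2) / (real N - 1)"
  shows "measure_pmf.expectation (swd N n)
      (\<lambda>Z. \<bar>(\<Sum>i\<in>group N Z p. (y i)\<^sup>2) / real (n p) - 2 * ((\<Sum>i\<in>group N Z p. y i) / real (n p))\<^sup>2
            - (\<Sum>i<N. (y i)\<^sup>2) / real N\<bar>)
    \<le> sqrt (K * v / real (n p)) + 2 * (v / real (n p))"
proof -
  let ?E = "measure_pmf.expectation (swd N n)"
  note int = integrable_swd[of n N, OF n]
  define \<mu> where "\<mu> = (\<Sum>i<N. (y i)\<^sup>2) / real N"
  define g where "g i = (y i)\<^sup>2 - \<mu>" for i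
  have N0: "real N > 0" "real N - 1 > 0" using N by simp_all
  have g0: "(\<Sum>i<N. g i) = 0" using N0 by (simp add: g_def \<mu>_def sum_subtractf)
  have fin: "finite (set_pmf (swd N n))" by (simp add: design_eq_perm[OF n] finite_set_perm_pmf)
  have G: "(\<Sum>i\<in>group N Z p. g i) / real (n p) = (\<Sum>i\<in>group N Z p. (y i)\<^sup>2) / real (n p) - \<mu>"
    if "Z \<in> set_pmf (swd N n)" for Z
    using set_pmf_swd[of n N Z p, OF n that] np by (simp add: g_def sum_subtractf diff_divide_distrib)
  have g2: "(\<Sum>i<N. (g i)\<^sup>2) \<le> K * (\<Sum>i<N. (y i)\<^sup>2)"
  proof -
    have "(\<Sum>i<N. (g i)\<^sup>2) = (\<Sum>i<N. ((y i)\<^sup>2)\<^sup>2 - 2 * \<mu> * (y i)\<^sup>2 + \<mu>\<^sup>2)"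
      by (simp add: g_def power2_diff algebra_simps)
    also have "\<dots> = (\<Sum>i<N. ((y i)\<^sup>2)\<^sup>2) - 2 * \<mu> * (\<Sum>i<N. (y i)\<^sup>2) + real N * \<mu>\<^sup>2"
      by (simp add: sum.distrib sum_subtractf sum_distrib_left)
    also have "(\<Sum>i<N. (y i)\<^sup>2) = real N * \<mu>" using N0 by (simp add: \<mu>_def)
    also have "(\<Sum>i<N. ((y i)\<^sup>2)\<^sup>2) - 2 * \<mu> * (real N * \<mu>) + real N * \<mu>\<^sup>2 = (\<Sum>i<N. ((y i)\<^sup>2)\<^sup>2) - real N * \<mu>\<^sup>2"
      by (simp add: power2_eq_square)
    also have "\<dots> \<le> (\<Sum>i<N. ((y i)\<^sup>2)\<^sup>2)" by simp
    also have "\<dots> \<le> (\<Sum>i<N. K * (y i)\<^sup>2)"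
    proof (rule sum_mono)
      fix i assume "i \<in> {..<N}"
      then show "((y i)\<^sup>2)\<^sup>2 \<le> K * (y i)\<^sup>2"
        using mult_right_mono[OF K, of i "(y i)\<^sup>2"] by (simp add: power2_eq_square)
    qed
    finally show ?thesis by (simp add: sum_distrib_left)
  qed
  have "?E (\<lambda>Z. \<bar>(\<Sum>i\<in>group N Z p. (y i)\<^sup>2) / real (n p) - 2 * ((\<Sum>i\<in>group N Z p. y i) / real (n p))\<^sup>2 - \<mu>\<bar>)
     \<le> ?E (\<lambda>Z. \<bar>(\<Sum>i\<in>group N Z p. g i) / real (n p)\<bar> + 2 * ((\<Sum>i\<in>group N Z p. y i) / real (n p))\<^sup>2)"
  proof (intro integral_mono_AE int AE_pmfI)
    fix Z assume "Z \<in> set_pmf (swd N n)"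
    from G[OF this] show "\<bar>(\<Sum>i\<in>group N Z p. (y i)\<^sup>2) / real (n p) - 2 * ((\<Sum>i\<in>group N Z p. y i) / real (n p))\<^sup>2 - \<mu>\<bar>
      \<le> \<bar>(\<Sum>i\<in>group N Z p. g i) / real (n p)\<bar> + 2 * ((\<Sum>i\<in>group N Z p. y i) / real (n p))\<^sup>2"
      using zero_le_power2[of "(\<Sum>i\<in>group N Z p. y i) / real (n p)"] by linarith
  qed
  also have "\<dots> = ?E (\<lambda>Z. \<bar>(\<Sum>i\<in>group N Z p. g i) / real (n p)\<bar>) + 2 * ?E (\<lambda>Z. ((\<Sum>i\<in>group N Z p. y i) / real (n p))\<^sup>2)"
    by (subst Bochner_Integration.integral_add) (auto simp: int)
  also have "?E (\<lambda>Z. \<bar>(\<Sum>i\<in>group N Z p. g i) / real (n p)\<bar>)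
     \<le> sqrt (?E (\<lambda>Z. ((\<Sum>i\<in>group N Z p. g i) / real (n p))\<^sup>2))"
    by (rule expectation_abs_le_sqrt[OF fin])
  also have "\<dots> \<le> sqrt (K * v / real (n p))"
  proof (rule real_sqrt_le_mono)
    have "?E (\<lambda>Z. ((\<Sum>i\<in>group N Z p. g i) / real (n p))\<^sup>2) \<le> (\<Sum>i<N. (g i)\<^sup>2) / ((real N - 1) * real (n p))"
      by (rule group_mean_square_le[OF n N g0])
    also have "\<dots> \<le> (K * (\<Sum>i<N. (y i)\<^sup>2)) / ((real N - 1) * real (n p))"
      using g2 N0 by (intro divide_right_mono) auto
    finally show "?E (\<lambda>Z. ((\<Sum>i\<in>group N Z p. g i) / real (n p))\<^sup>2) \<le> K * v / real (n p)"
      by (simp add: v_def)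
  qed
  also have "?E (\<lambda>Z. ((\<Sum>i\<in>group N Z p. y i) / real (n p))\<^sup>2) \<le> v / real (n p)"
    using group_mean_square_le[OF n N y0, of p] by (simp add: v_def)
  finally show ?thesis by (simp add: \<mu>_def)
qed

lemma svar_lower_bound:
  fixes f :: "nat \<Rightarrow> real"
  assumes n: "card S \<ge> 2"
  shows "(\<Sum>i\<in>S. (f i - \<mu>)\<^sup>2) / real (card S) - 2 * ((\<Sum>i\<in>S. f i - \<mu>) / real (card S))\<^sup>2 \<le> svar S f"
proof -
  define n where "n = real (card S)"
  have n2: "n \<ge> 2" using assms by (simp add: n_def)
  define A where "A = (\<Sum>i\<in>S. (f i - \<mu>)\<^sup>2)"
  define b where "b = (\<Sum>i\<in>S. f i - \<mu>) / n"
  have sb: "(\<Sum>i\<in>S. f i - \<mu>) = n * b" using n2 by (simp add: b_def)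
  have m: "smean S f = b + \<mu>"
    using n2 by (simp add: smean_def b_def sum_subtractf diff_divide_distrib flip: n_def)
  have "(\<Sum>i\<in>S. (f i - smean S f)\<^sup>2) = (\<Sum>i\<in>S. (f i - \<mu>)\<^sup>2 - 2 * b * (f i - \<mu>) + b\<^sup>2)"
    unfolding m by (intro sum.cong) (auto simp: power2_eq_square algebra_simps)
  also have "\<dots> = A - (\<Sum>i\<in>S. 2 * b * (f i - \<mu>)) + n * b\<^sup>2"
    unfolding sum.distrib by (subst sum_subtractf) (simp add: A_def n_def)
  also have "(\<Sum>i\<in>S. 2 * b * (f i - \<mu>)) = 2 * b * (n * b)"
    unfolding sb[symmetric] by (rule sum_distrib_left[symmetric])
  also have "A - 2 * b * (n * b) + n * b\<^sup>2 = A - n * b\<^sup>2" by (simp add: power2_eq_square)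
  finally have "svar S f = (A - n * b\<^sup>2) / (n - 1)" by (simp add: svar_def n_def)
  moreover have "A / n \<le> A / (n - 1)"
    using n2 by (intro divide_left_mono) (auto simp: A_def intro: sum_nonneg)
  moreover have "n * b\<^sup>2 / (n - 1) \<le> 2 * b\<^sup>2"
  proof -
    have "n * b\<^sup>2 \<le> 2 * (n - 1) * b\<^sup>2" using n2 by (intro mult_right_mono) auto
    then show ?thesis using n2 by (simp add: divide_le_eq algebra_simps)
  qed
  ultimately show ?thesis unfolding A_def[symmetric] n_def[symmetric] b_def[symmetric]
    by (simp add: diff_divide_distrib)
qed

section \<open>Coverage of the Wald interval\<close>

lemma pmean_centred: "(\<Sum>i<N. x i - pmean N x) = 0"
  by (cases "N = 0") (simp_all add: pmean_def sum_subtractf)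

lemma wald_coverage:
  fixes n :: "nat \<Rightarrow> path \<Rightarrow> nat" and x :: "path \<Rightarrow> nat \<Rightarrow> nat \<Rightarrow> real" and \<sigma> :: "path \<Rightarrow> real"
  defines "y \<equiv> \<lambda>N i p. x p N i - pmean N (x p N)"
  defines "S \<equiv> \<lambda>N Z. \<Sum>i<N. \<sigma> (Z i) * y N i (Z i) / real (n N (Z i))"
  defines "V \<equiv> \<lambda>N Z. \<Sum>p\<in>UNIV. svar (group N Z p) (x p N) / real (n N p)"
  assumes \<sigma>: "\<And>p. \<bar>\<sigma> p\<bar> = 1"
    and n: "\<forall>\<^sub>F N in sequentially. n N PV1V2 + n N PCV2 + n N PCC = N"
    and frac: "\<And>p. \<exists>l>0. (\<lambda>N. real (n N p) / real N) \<longlonglongrightarrow> l"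
    and cov: "\<And>p. \<exists>l. (\<lambda>N. pcov N (x p N) (x p N)) \<longlonglongrightarrow> l"
    and mx: "\<And>p. (\<lambda>N. Max ((\<lambda>i. (x p N i - pmean N (x p N))\<^sup>2) ` {..<N}) / real N) \<longlonglongrightarrow> 0"
    and var: "(\<lambda>N. real N * measure_pmf.expectation (swd N (n N)) (\<lambda>Z. (S N Z)\<^sup>2)) \<longlonglongrightarrow> L" and L: "L > 0"
    and q: "q > 0" and e: "e > 0"
  shows "\<forall>\<^sub>F N in sequentially. 2 * Phi q - 1 - e
            < measure_pmf.prob (swd N (n N)) {Z. \<bar>S N Z\<bar> < q * sqrt (V N Z)}"
proof -
  obtain l where l: "l p > 0" "(\<lambda>N. real (n N p) / real N) \<longlonglongrightarrow> l p" for p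
    using frac by metis
  obtain c where c: "(\<lambda>N. pcov N (x p N) (x p N)) \<longlonglongrightarrow> c p" for p
    using cov by metis
  define K where "K p N = Max ((\<lambda>i. (y N i p)\<^sup>2) ` {..<N})" for p N
  define v where "v p N = (\<Sum>i<N. (y N i p)\<^sup>2) / (real N - 1)" for p N
  define r where "r p N = real N / real (n N p)" for p N
  have K: "(\<lambda>N. K p N / real N) \<longlonglongrightarrow> 0" for p using mx by (simp add: K_def y_def)
  have v: "v p \<longlonglongrightarrow> c p" for p
    using c[of p] by (simp add: v_def[abs_def] pcov_def y_def power2_eq_square)
  have r: "r p \<longlonglongrightarrow> 1 / l p" for p
    using tendsto_divide[OF tendsto_const[of 1] l(2)[of p]] l(1)[of p] by (simp add: r_def[abs_def])
  have y0: "(\<Sum>i<N. y N i p) = 0" for N p unfolding y_def by (rule pmean_centred)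
  have yK: "(y N i p)\<^sup>2 \<le> K p N" if "i < N" for N i p
    unfolding K_def using that by (intro Max_ge) auto
  have n_top: "filterlim (\<lambda>N. real (n N p)) at_top sequentially" for p
  proof -
    have A: "filterlim (\<lambda>N. (real (n N p) / real N) * real N) at_top sequentially"
      by (rule filterlim_tendsto_pos_mult_at_top[OF l(2) l(1) filterlim_real_sequentially])
    have ev: "\<forall>\<^sub>F N in sequentially. (real (n N p) / real N) * real N = real (n N p)"
      using eventually_gt_at_top[of 0] by eventually_elim simp
    show ?thesis by (rule iffD1[OF filterlim_cong[OF refl refl ev] A])
  qed
  have n2: "\<forall>\<^sub>F N in sequentially. \<forall>p. n N p \<ge> 2"
  proof -
    have "\<forall>\<^sub>F N in sequentially. n N p \<ge> 2" for p
      using filterlim_at_top_dense[THEN iffD1, OF n_top[of p], rule_format, of 1]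
      by eventually_elim simp
    then have "\<forall>\<^sub>F N in sequentially. \<forall>p\<in>UNIV. n N p \<ge> 2"
      by (subst eventually_ball_finite_distrib) (auto simp: finite_UNIV_path)
    then show ?thesis by simp
  qed
  have good: "\<forall>\<^sub>F N in sequentially. n N PV1V2 + n N PCV2 + n N PCC = N \<and> (\<forall>p. n N p \<ge> 2) \<and> N \<ge> 2"
    using n n2 eventually_ge_at_top[of 2] by eventually_elim auto

  define w where "w N i p = sqrt (real N) * (\<sigma> p * y N i p / real (n N p)) / sqrt L" for N i p
  have wS: "(\<Sum>i<N. w N i (Z i)) = sqrt (real N) * S N Z / sqrt L" for N Z
    unfolding w_def S_def by (simp add: sum_distrib_left sum_divide_distrib)
  have \<sigma>2: "(\<sigma> p)\<^sup>2 = 1" for p using \<sigma>[of p] by (metis one_power2 power2_abs)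
  have w2: "(w N i p)\<^sup>2 = (r p N)\<^sup>2 / L * ((y N i p)\<^sup>2 / real N)" for N i p
  proof -
    have "(w N i p)\<^sup>2 = real N * ((y N i p)\<^sup>2 / (real (n N p))\<^sup>2) / L"
      using L by (simp add: w_def power_mult_distrib power_divide \<sigma>2)
    then show ?thesis
      by (cases "N = 0") (simp_all add: r_def power_divide power2_eq_square[of "real N"])
  qed
  have clt: "weak_conv_m (\<lambda>N. distr (measure_pmf (swd N (n N))) borel (\<lambda>Z. \<Sum>i<N. w N i (Z i))) std_normal_distribution"
  proof (rule design_clt)
    show "\<forall>\<^sub>F N in sequentially. n N PV1V2 + n N PCV2 + n N PCC = N" by (rule n)
    show "(\<Sum>i<N. w N i p) = 0" for N p
    proof -
      have "(\<Sum>i<N. w N i p) = sqrt (real N) * \<sigma> p / real (n N p) / sqrt L * (\<Sum>i<N. y N i p)"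
        unfolding sum_distrib_left by (intro sum.cong) (auto simp: w_def)
      then show ?thesis by (simp add: y0)
    qed
    define b where "b p = (1 / l p)\<^sup>2 / L * c p + 1" for p
    show "\<forall>\<^sub>F N in sequentially. \<forall>p. (\<Sum>i<N. (w N i p)\<^sup>2) \<le> (\<Sum>p\<in>UNIV. \<bar>b p\<bar>)"
    proof -
      have "\<forall>\<^sub>F N in sequentially. (\<Sum>i<N. (w N i p)\<^sup>2) \<le> (\<Sum>p\<in>UNIV. \<bar>b p\<bar>)" for p
      proof -
        have "(\<lambda>N. (r p N)\<^sup>2 / L * v p N) \<longlonglongrightarrow> (1 / l p)\<^sup>2 / L * c p"
          using L by (intro tendsto_intros r v) auto
        then have "\<forall>\<^sub>F N in sequentially. (r p N)\<^sup>2 / L * v p N < b p"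
          by (rule order_tendstoD) (simp add: b_def)
        then show ?thesis using eventually_ge_at_top[of 2]
        proof eventually_elim
          case (elim N)
          have "(\<Sum>i<N. (w N i p)\<^sup>2) = (r p N)\<^sup>2 / L * ((\<Sum>i<N. (y N i p)\<^sup>2) / real N)"
            by (simp add: w2 sum_distrib_left sum_divide_distrib)
          also have "\<dots> \<le> (r p N)\<^sup>2 / L * v p N"
            unfolding v_def using elim L
            by (intro mult_left_mono divide_left_mono) (auto intro!: sum_nonneg)
          also have "\<dots> \<le> \<bar>b p\<bar>" using elim by simp
          also have "\<dots> \<le> (\<Sum>p\<in>UNIV. \<bar>b p\<bar>)"
            by (rule member_le_sum) (auto simp: finite_UNIV_path)
          finally show ?case .
        qed
      qed
      then have "\<forall>\<^sub>F N in sequentially. \<forall>p\<in>UNIV. (\<Sum>i<N. (w N i p)\<^sup>2) \<le> (\<Sum>p\<in>UNIV. \<bar>b p\<bar>)"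
        by (subst eventually_ball_finite_distrib) (auto simp: finite_UNIV_path)
      then show ?thesis by simp
    qed
    define M where "M N = (\<Sum>p\<in>UNIV. sqrt ((r p N)\<^sup>2 / L * (K p N / real N)))" for N
    have K0: "0 \<le> (r p N)\<^sup>2 / L * (K p N / real N)" for p N
    proof (cases "N = 0")
      case False
      then have "0 \<le> K p N" using yK[of 0 N p] zero_le_power2[of "y N 0 p"] by linarith
      then show ?thesis using L by simp
    qed simp
    show "\<forall>\<^sub>F N in sequentially. \<forall>i<N. \<forall>p. \<bar>w N i p\<bar> \<le> M N"
    proof (intro always_eventually allI impI)
      fix N i :: nat and p assume i: "i < N"
      have "(w N i p)\<^sup>2 \<le> (r p N)\<^sup>2 / L * (K p N / real N)"
        unfolding w2 using yK[OF i] L by (intro mult_left_mono divide_right_mono) auto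
      then have "\<bar>w N i p\<bar> \<le> sqrt ((r p N)\<^sup>2 / L * (K p N / real N))"
        by (intro real_le_rsqrt) simp
      also have "\<dots> \<le> M N"
        unfolding M_def
        by (rule member_le_sum) (use K0 in \<open>simp_all only: finite_UNIV_path UNIV_I real_sqrt_ge_zero\<close>)
      finally show "\<bar>w N i p\<bar> \<le> M N" .
    qed
    have "M \<longlonglongrightarrow> (\<Sum>p\<in>UNIV. sqrt ((1 / l p)\<^sup>2 / L * 0))"
      unfolding M_def using L
      by (intro tendsto_sum tendsto_real_sqrt tendsto_mult tendsto_divide tendsto_power tendsto_const r K) auto
    then show "M \<longlonglongrightarrow> 0" by simp
    have "(\<lambda>N. real N * measure_pmf.expectation (swd N (n N)) (\<lambda>Z. (S N Z)\<^sup>2) / L) \<longlonglongrightarrow> L / L"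
      using L by (intro tendsto_divide var tendsto_const) auto
    moreover have "(\<Sum>i<N. w N i (Z i))\<^sup>2 = real N / L * (S N Z)\<^sup>2" for N Z
      using L by (simp add: wS power_mult_distrib power_divide)
    ultimately show "(\<lambda>N. measure_pmf.expectation (swd N (n N)) (\<lambda>Z. (\<Sum>i<N. w N i (Z i))\<^sup>2)) \<longlonglongrightarrow> 1"
      using L by simp
  qed

  obtain x0 where x0: "0 < x0" "x0 < q" "Phi q - e / 4 < Phi x0"
  proof -
    have "(Phi \<longlongrightarrow> Phi q) (at_left q)"
      using isCont_Phi[of q] by (simp add: continuous_at_imp_continuous_at_within continuous_within[symmetric])
    then have "\<forall>\<^sub>F t in at_left q. Phi q - e / 4 < Phi t"
      by (rule order_tendstoD) (use e in simp)
    moreover have "\<forall>\<^sub>F t in at_left q. t \<in> {0<..<q}"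
      using q by (rule eventually_at_leftI[rotated]) auto
    ultimately have "\<forall>\<^sub>F t in at_left q. Phi q - e / 4 < Phi t \<and> t \<in> {0<..<q}"
      by (rule eventually_conj)
    then show ?thesis using that eventually_happens[of _ "at_left q"] by auto
  qed
  have cov_lim: "(\<lambda>N. measure_pmf.prob (swd N (n N)) {Z. - x0 < (\<Sum>i<N. w N i (Z i)) \<and> (\<Sum>i<N. w N i (Z i)) \<le> x0})
     \<longlonglongrightarrow> 2 * Phi x0 - 1"
    by (rule weak_conv_std_normal_two_sided[OF clt x0(1)])

  define \<delta> where "\<delta> = L * (1 - x0\<^sup>2 / q\<^sup>2)"
  have "x0\<^sup>2 < q\<^sup>2" using x0 by (intro power_strict_mono) auto
  then have \<delta>: "\<delta> > 0" using L q by (simp add: \<delta>_def)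
  define R where "R p N Z = (\<Sum>i\<in>group N Z p. (y N i p)\<^sup>2) / real (n N p)
      - 2 * ((\<Sum>i\<in>group N Z p. y N i p) / real (n N p))\<^sup>2" for p N Z
  define \<mu> where "\<mu> p N = (\<Sum>i<N. (y N i p)\<^sup>2) / real N" for p N
  define F where "F N Z = (\<Sum>p\<in>UNIV. r p N * \<bar>R p N Z - \<mu> p N\<bar>)" for N Z
  define \<eta> where "\<eta> p N = sqrt ((K p N / real N) * r p N * v p N) + 2 * (v p N * inverse (real (n N p)))" for p N
  have "\<eta> p \<longlonglongrightarrow> sqrt (0 * (1 / l p) * c p) + 2 * (c p * 0)" for p
    unfolding \<eta>_def
    by (intro tendsto_add tendsto_mult tendsto_real_sqrt tendsto_const K r v
        filterlim_compose[OF tendsto_inverse_0_at_top[OF filterlim_ident] n_top])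
  then have \<eta>: "\<eta> p \<longlonglongrightarrow> 0" for p by simp
  have EF_le: "\<forall>\<^sub>F N in sequentially. norm (measure_pmf.expectation (swd N (n N)) (F N)) \<le> (\<Sum>p\<in>UNIV. r p N * \<eta> p N)"
    using good
  proof eventually_elim
    case (elim N)
    then have sN: "n N PV1V2 + n N PCV2 + n N PCC = N" and N2: "N \<ge> 2" by auto
    have r0: "r p N \<ge> 0" for p by (simp add: r_def)
    have "measure_pmf.expectation (swd N (n N)) (F N)
       = (\<Sum>p\<in>UNIV. r p N * measure_pmf.expectation (swd N (n N)) (\<lambda>Z. \<bar>R p N Z - \<mu> p N\<bar>))"
      unfolding F_def
      by (subst Bochner_Integration.integral_sum) (auto intro: integrable_swd[OF sN])
    also have "\<dots> \<le> (\<Sum>p\<in>UNIV. r p N * \<eta> p N)"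
    proof (intro sum_mono mult_left_mono r0)
      fix p
      have np: "0 < n N p" using elim by (metis not_numeral_le_zero not_gr_zero)
      have "measure_pmf.expectation (swd N (n N)) (\<lambda>Z. \<bar>R p N Z - \<mu> p N\<bar>)
        \<le> sqrt (K p N * v p N / real (n N p)) + 2 * (v p N / real (n N p))"
        unfolding R_def \<mu>_def v_def
        by (rule group_second_moment_L1[OF sN N2 np y0]) (rule yK)
      also have "K p N * v p N / real (n N p) = (K p N / real N) * r p N * v p N"
        using N2 by (simp add: r_def)
      finally show "measure_pmf.expectation (swd N (n N)) (\<lambda>Z. \<bar>R p N Z - \<mu> p N\<bar>) \<le> \<eta> p N"
        by (simp add: \<eta>_def divide_inverse)
    qed
    finally have "measure_pmf.expectation (swd N (n N)) (F N) \<le> (\<Sum>p\<in>UNIV. r p N * \<eta> p N)" .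
    moreover have "0 \<le> measure_pmf.expectation (swd N (n N)) (F N)"
      by (rule Bochner_Integration.integral_nonneg) (auto simp: F_def r0 intro!: sum_nonneg)
    ultimately show ?case by simp
  qed
  have "(\<lambda>N. \<Sum>p\<in>UNIV. r p N * \<eta> p N) \<longlonglongrightarrow> (\<Sum>p\<in>UNIV. 1 / l p * 0)"
    by (intro tendsto_sum tendsto_mult r \<eta>)
  then have EF: "(\<lambda>N. measure_pmf.expectation (swd N (n N)) (F N)) \<longlonglongrightarrow> 0"
    by (intro Lim_null_comparison[OF EF_le]) simp
  have small: "\<forall>\<^sub>F N in sequentially. measure_pmf.prob (swd N (n N)) {Z. F N Z \<ge> \<delta> / 2} < e / 4"
  proof -
    have "\<forall>\<^sub>F N in sequentially. measure_pmf.expectation (swd N (n N)) (F N) < \<delta> / 2 * (e / 4)"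
      using EF by (rule order_tendstoD) (use \<delta> e in simp)
    then show ?thesis using good
    proof eventually_elim
      case (elim N)
      then have sN: "n N PV1V2 + n N PCV2 + n N PCC = N" by auto
      have "measure_pmf.prob (swd N (n N)) {Z \<in> space (measure_pmf (swd N (n N))). F N Z \<ge> \<delta> / 2}
         \<le> measure_pmf.expectation (swd N (n N)) (F N) / (\<delta> / 2)"
        by (rule integral_Markov_inequality_measure[where A = "{}"])
          (use \<delta> in \<open>auto intro!: integrable_swd[OF sN] sum_nonneg simp: F_def r_def\<close>)
      also have "\<dots> < e / 4" using elim \<delta> by (simp add: divide_less_eq mult.commute)
      finally show ?case by simp
    qed
  qed

  txt \<open>Neyman's conservativeness: dropping the nonpositive term of the exact variance of the
    estimator leaves the limit of the variance estimator.\<close>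
  have mean_V: "\<forall>\<^sub>F N in sequentially. L - \<delta> / 2 < (\<Sum>p\<in>UNIV. r p N * \<mu> p N)"
  proof -
    have "(\<lambda>N. (real N - 1) / real N) \<longlonglongrightarrow> 1" by real_asymp
    from tendsto_mult[OF this var]
    have "\<forall>\<^sub>F N in sequentially. L - \<delta> / 2 < (real N - 1) / real N * (real N * measure_pmf.expectation (swd N (n N)) (\<lambda>Z. (S N Z)\<^sup>2))"
      by (rule order_tendstoD) (use \<delta> in simp)
    then show ?thesis using good
    proof eventually_elim
      case (elim N)
      then have sN: "n N PV1V2 + n N PCV2 + n N PCC = N" and N2: "N \<ge> 2" by auto
      have N0: "real N > 0" "real N - 1 > 0" using N2 by auto
      have np: "real (n N p) > 0" for p using elim by (metis not_numeral_le_zero not_gr_zero of_nat_0_less_iff)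
      have "measure_pmf.expectation (swd N (n N)) (\<lambda>Z. (S N Z)\<^sup>2)
         \<le> (\<Sum>p\<in>UNIV. real (n N p) * (\<Sum>i<N. (\<sigma> p * y N i p / real (n N p))\<^sup>2)) / (real N - 1)"
        unfolding S_def
      proof (rule swd_sum_square_le[OF sN N2, of "\<lambda>i p. \<sigma> p * y N i p / real (n N p)"])
        show "(\<Sum>i<N. \<sigma> p * y N i p / real (n N p)) = 0" for p
          using y0[of N p] by (simp flip: sum_distrib_left sum_divide_distrib)
      qed
      also have "(\<Sum>p\<in>UNIV. real (n N p) * (\<Sum>i<N. (\<sigma> p * y N i p / real (n N p))\<^sup>2)) = (\<Sum>p\<in>UNIV. r p N * \<mu> p N)"
      proof (intro sum.cong refl)
        fix p
        have "(\<Sum>i<N. (\<sigma> p * y N i p / real (n N p))\<^sup>2) = (\<Sum>i<N. (y N i p)\<^sup>2) / (real (n N p))\<^sup>2"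
          by (simp add: power_divide power_mult_distrib \<sigma>2 sum_divide_distrib)
        then show "real (n N p) * (\<Sum>i<N. (\<sigma> p * y N i p / real (n N p))\<^sup>2) = r p N * \<mu> p N"
          using np[of p] N0 by (simp add: r_def \<mu>_def power2_eq_square)
      qed
      finally have "(real N - 1) * measure_pmf.expectation (swd N (n N)) (\<lambda>Z. (S N Z)\<^sup>2) \<le> (\<Sum>p\<in>UNIV. r p N * \<mu> p N)"
        using N0 by (simp add: le_divide_eq mult.commute)
      then show ?case using elim N0 by simp
    qed
  qed

  have "\<forall>\<^sub>F N in sequentially. 2 * Phi x0 - 1 - e / 4
      < measure_pmf.prob (swd N (n N)) {Z. - x0 < (\<Sum>i<N. w N i (Z i)) \<and> (\<Sum>i<N. w N i (Z i)) \<le> x0}"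
    using cov_lim by (rule order_tendstoD) (use e in simp)
  then show ?thesis using small mean_V good
  proof eventually_elim
    case (elim N)
    then have sN: "n N PV1V2 + n N PCV2 + n N PCC = N" and N2: "N \<ge> 2" and np: "\<And>p. n N p \<ge> 2" by auto
    let ?A = "{Z. - x0 < (\<Sum>i<N. w N i (Z i)) \<and> (\<Sum>i<N. w N i (Z i)) \<le> x0}"
    let ?B = "{Z. F N Z \<ge> \<delta> / 2}" and ?G = "{Z. \<bar>S N Z\<bar> < q * sqrt (V N Z)}"
    have "measure_pmf.prob (swd N (n N)) ?A \<le> measure_pmf.prob (swd N (n N)) (?G \<union> ?B)"
    proof (rule measure_pmf.finite_measure_mono_AE)
      show "AE Z in measure_pmf (swd N (n N)). Z \<in> ?A \<longrightarrow> Z \<in> ?G \<union> ?B"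
      proof (intro AE_pmfI impI)
        fix Z assume Z: "Z \<in> set_pmf (swd N (n N))" and ZA: "Z \<in> ?A"
        show "Z \<in> ?G \<union> ?B"
        proof (cases "Z \<in> ?B")
          case False
          have "R p N Z \<le> svar (group N Z p) (x p N)" for p
            using svar_lower_bound[of "group N Z p" "x p N" "pmean N (x p N)"] set_pmf_swd[OF sN Z, of p] np[of p]
            by (simp add: R_def y_def)
          then have "(\<Sum>p\<in>UNIV. r p N * R p N Z) \<le> (\<Sum>p\<in>UNIV. r p N * svar (group N Z p) (x p N))"
            by (intro sum_mono mult_left_mono) (auto simp: r_def)
          also have "\<dots> = real N * V N Z"
            by (simp add: V_def r_def sum_distrib_left)
          finally have 1: "(\<Sum>p\<in>UNIV. r p N * R p N Z) \<le> real N * V N Z" .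
          have "(\<Sum>p\<in>UNIV. r p N * \<mu> p N) - F N Z = (\<Sum>p\<in>UNIV. r p N * (\<mu> p N - \<bar>R p N Z - \<mu> p N\<bar>))"
            by (simp add: F_def sum_subtractf right_diff_distrib)
          also have "\<dots> \<le> (\<Sum>p\<in>UNIV. r p N * R p N Z)"
            by (intro sum_mono mult_left_mono) (auto simp: r_def)
          finally have "L - \<delta> < real N * V N Z" using 1 False elim(3) by simp
          then have "q\<^sup>2 * (L - \<delta>) < q\<^sup>2 * (real N * V N Z)" using q by simp
          moreover have "q\<^sup>2 * (L - \<delta>) = x0\<^sup>2 * L" using q by (simp add: \<delta>_def field_simps)
          ultimately have a: "x0\<^sup>2 * L < q\<^sup>2 * (real N * V N Z)" by simp
          have "\<bar>\<Sum>i<N. w N i (Z i)\<bar> \<le> x0" using ZA by auto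
          then have "(\<Sum>i<N. w N i (Z i))\<^sup>2 \<le> x0\<^sup>2" using x0(1) by (simp add: abs_le_square_iff[symmetric])
          then have "real N * (S N Z)\<^sup>2 \<le> x0\<^sup>2 * L"
            using L by (simp add: wS power_mult_distrib power_divide divide_le_eq)
          with a have "real N * (S N Z)\<^sup>2 < real N * (q\<^sup>2 * V N Z)" by (simp add: mult.left_commute)
          then have "(S N Z)\<^sup>2 < q\<^sup>2 * V N Z" using N2 by simp
          then have "sqrt ((S N Z)\<^sup>2) < sqrt (q\<^sup>2 * V N Z)" by (rule real_sqrt_less_mono)
          then show ?thesis using q by (simp add: real_sqrt_mult)
        qed simp
      qed
    qed simp
    also have "\<dots> \<le> measure_pmf.prob (swd N (n N)) ?G + measure_pmf.prob (swd N (n N)) ?B"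
      by (rule measure_Un_le) auto
    finally show ?case using elim(1,2) x0(3) by simp
  qed
qed

definition path_outcome :: "(nat \<Rightarrow> trt \<Rightarrow> real) \<Rightarrow> (nat \<Rightarrow> trt \<Rightarrow> trt \<Rightarrow> real) \<Rightarrow> path \<Rightarrow> nat \<Rightarrow> real" where
  "path_outcome Y1 Y2 p i = (case p of PV1V2 \<Rightarrow> Y1 i V1 | PCV2 \<Rightarrow> Y2 i C V2 | PCC \<Rightarrow> Y2 i C C - Y1 i C)"

definition path_sign :: "path \<Rightarrow> real" where
  "path_sign p = (case p of PCV2 \<Rightarrow> 1 | _ \<Rightarrow> - 1)"

lemma z1_V1_iff: "z1 p = V1 \<longleftrightarrow> p = PV1V2"
  by (cases p) auto

lemma group_V1: "{i. i < N \<and> z1 (Z i) = V1} = group N Z PV1V2"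
  by (simp add: group_def z1_V1_iff)

lemma svar_cong:
  assumes "\<And>i. i \<in> S \<Longrightarrow> f i = g i"
  shows "svar S f = svar S g"
proof -
  have "smean S f = smean S g" using assms by (simp add: smean_def)
  then show ?thesis using assms by (simp add: svar_def)
qed

lemma V_hat_eq:
  "V_hat N (n PV1V2) (n PCV2) (n PCC) Y1 Y2 Z
     = (\<Sum>p\<in>UNIV. svar (group N Z p) (path_outcome Y1 Y2 p) / real (n p))"
proof -
  have "svar (group N Z PCV2) (\<lambda>i. Y2 i (z1 (Z i)) (z2 (Z i))) = svar (group N Z PCV2) (path_outcome Y1 Y2 PCV2)"
    "svar (group N Z PV1V2) (\<lambda>i. Y1 i (z1 (Z i))) = svar (group N Z PV1V2) (path_outcome Y1 Y2 PV1V2)"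
    "svar (group N Z PCC) (\<lambda>i. Y2 i (z1 (Z i)) (z2 (Z i)) - Y1 i (z1 (Z i))) = svar (group N Z PCC) (path_outcome Y1 Y2 PCC)"
    by (auto intro!: svar_cong simp: group_def path_outcome_def)
  then show ?thesis
    by (simp add: V_hat_def Let_def group_V1 UNIV_path)
qed

lemma tau_hat_eq:
  assumes n: "\<And>p. card (group N Z p) = n p" "\<And>p. n p > 0"
    and consistency: "\<And>i. i < N \<Longrightarrow> Y2 i C V2 - Y2 i C C = Y1 i V2 - Y1 i C"
  shows "tau_hat N (n PV1V2) (n PCV2) (n PCC) Y1 Y2 Z
     = (\<Sum>i<N. Y1 i V2 - Y1 i V1) / real N
     + (\<Sum>i<N. path_sign (Z i) * (path_outcome Y1 Y2 (Z i) i - pmean N (path_outcome Y1 Y2 (Z i))) / real (n (Z i)))"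
proof -
  let ?x = "path_outcome Y1 Y2"
  have mean: "(\<Sum>i\<in>group N Z p. ?x p i) / real (n p)
     = pmean N (?x p) + (\<Sum>i\<in>group N Z p. (?x p i - pmean N (?x p)) / real (n p))" for p
    using n[of p] by (simp add: sum_subtractf diff_divide_distrib flip: sum_divide_distrib)
  have "tau_hat N (n PV1V2) (n PCV2) (n PCC) Y1 Y2 Z
     = (\<Sum>i\<in>group N Z PCV2. ?x PCV2 i) / real (n PCV2) - (\<Sum>i\<in>group N Z PV1V2. ?x PV1V2 i) / real (n PV1V2)
       - (\<Sum>i\<in>group N Z PCC. ?x PCC i) / real (n PCC)"
  proof -
    have "(\<Sum>i\<in>group N Z PCV2. Y2 i (z1 (Z i)) (z2 (Z i))) = (\<Sum>i\<in>group N Z PCV2. ?x PCV2 i)"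
      "(\<Sum>i\<in>group N Z PV1V2. Y1 i (z1 (Z i))) = (\<Sum>i\<in>group N Z PV1V2. ?x PV1V2 i)"
      "(\<Sum>i\<in>group N Z PCC. Y2 i (z1 (Z i)) (z2 (Z i)) - Y1 i (z1 (Z i))) = (\<Sum>i\<in>group N Z PCC. ?x PCC i)"
      by (auto intro!: sum.cong simp: group_def path_outcome_def)
    then show ?thesis by (simp add: tau_hat_def Let_def group_V1)
  qed
  also have "\<dots> = (pmean N (?x PCV2) - pmean N (?x PV1V2) - pmean N (?x PCC))
     + (\<Sum>p\<in>UNIV. \<Sum>i\<in>group N Z p. path_sign p * (?x p i - pmean N (?x p)) / real (n p))"
  proof -
    have "(\<Sum>i\<in>group N Z p. path_sign p * (?x p i - pmean N (?x p)) / real (n p))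
       = path_sign p * (\<Sum>i\<in>group N Z p. (?x p i - pmean N (?x p)) / real (n p))" for p
      by (simp add: sum_distrib_left)
    then show ?thesis unfolding mean by (simp add: UNIV_path path_sign_def)
  qed
  also have "pmean N (?x PCV2) - pmean N (?x PV1V2) - pmean N (?x PCC) = (\<Sum>i<N. Y1 i V2 - Y1 i V1) / real N"
  proof -
    have "(\<Sum>i<N. ?x PCV2 i - ?x PV1V2 i - ?x PCC i) = (\<Sum>i<N. Y1 i V2 - Y1 i V1)"
      using consistency by (intro sum.cong) (auto simp: path_outcome_def algebra_simps)
    then show ?thesis by (simp add: pmean_def sum_subtractf flip: diff_divide_distrib)
  qed
  also have "(\<Sum>p\<in>UNIV. \<Sum>i\<in>group N Z p. path_sign p * (?x p i - pmean N (?x p)) / real (n p))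
     = (\<Sum>i<N. path_sign (Z i) * (?x (Z i) i - pmean N (?x (Z i))) / real (n (Z i)))"
    by (rule sum_by_group[symmetric])
  finally show ?thesis .
qed

theorem theorem2:
  fixes Nv1 Ncv2 Ncc :: "nat \<Rightarrow> nat"
    and Y1 :: "nat \<Rightarrow> nat \<Rightarrow> trt \<Rightarrow> real"
    and Y2 :: "nat \<Rightarrow> nat \<Rightarrow> trt \<Rightarrow> trt \<Rightarrow> real"
    and \<alpha> :: real
  defines "a \<equiv> (\<lambda>N i. Y1 N i V1)"
    and "b \<equiv> (\<lambda>N i. Y2 N i C V2)"
    and "d \<equiv> (\<lambda>N i. Y2 N i C C - Y1 N i C)"
    and "tau1 \<equiv> (\<lambda>N. (\<Sum>i<N. Y1 N i V2 - Y1 N i V1) / real N)"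
    and "Var_tau_hat \<equiv> (\<lambda>N. let P = design N (Nv1 N) (Ncv2 N) (Ncc N);
           T = tau_hat N (Nv1 N) (Ncv2 N) (Ncc N) (Y1 N) (Y2 N) in
           measure_pmf.expectation P (\<lambda>Z. (T Z - measure_pmf.expectation P T)^2))"
  assumes sizes: "\<forall>\<^sub>F N in sequentially. Nv1 N + Ncv2 N + Ncc N = N
           \<and> 0 < Nv1 N \<and> 0 < Ncv2 N \<and> 0 < Ncc N"
    and consistency: "\<And>N i v. i < N \<Longrightarrow> v \<in> {V1, V2} \<Longrightarrow>
           Y2 N i C v - Y2 N i C C = Y1 N i v - Y1 N i C"
    and lim_v1: "\<exists>L. 0 < L \<and> L < 1 \<and> (\<lambda>N. real (Nv1 N) / real N) \<longlonglongrightarrow> L"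
    and lim_cv2: "\<exists>L. 0 < L \<and> L < 1 \<and> (\<lambda>N. real (Ncv2 N) / real N) \<longlonglongrightarrow> L"
    and lim_cc: "\<exists>L. 0 < L \<and> L < 1 \<and> (\<lambda>N. real (Ncc N) / real N) \<longlonglongrightarrow> L"
    and lim_cov: "\<And>x y. x \<in> {a, b, d} \<Longrightarrow> y \<in> {a, b, d} \<Longrightarrow>
           \<exists>L. (\<lambda>N. pcov N (x N) (y N)) \<longlonglongrightarrow> L"
    and lim_var: "\<exists>L>0. (\<lambda>N. real N * Var_tau_hat N) \<longlonglongrightarrow> L"
    and lim_max: "\<And>x. x \<in> {a, b, d} \<Longrightarrow>
           (\<lambda>N. Max ((\<lambda>i. (x N i - pmean N (x N))^2) ` {..<N}) / real N) \<longlonglongrightarrow> 0"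
    and alpha: "0 < \<alpha>" "\<alpha> < 1"
  shows "liminf (\<lambda>N. ereal (measure_pmf.prob (design N (Nv1 N) (Ncv2 N) (Ncc N))
           {Z. let T = tau_hat N (Nv1 N) (Ncv2 N) (Ncc N) (Y1 N) (Y2 N) Z;
                   V = V_hat N (Nv1 N) (Ncv2 N) (Ncc N) (Y1 N) (Y2 N) Z;
                   q = normal_quantile (1 - \<alpha> / 2) in
               T - q * sqrt V < tau1 N \<and> tau1 N < T + q * sqrt V}))
         \<ge> ereal (1 - \<alpha>)"
proof -
  define n where "n N p = (case p of PV1V2 \<Rightarrow> Nv1 N | PCV2 \<Rightarrow> Ncv2 N | PCC \<Rightarrow> Ncc N)" for N p
  define x where "x p N = path_outcome (Y1 N) (Y2 N) p" for p N
  define S where "S N Z = (\<Sum>i<N. path_sign (Z i) * (x (Z i) N i - pmean N (x (Z i) N)) / real (n N (Z i)))" for N Z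
  define V where "V N Z = (\<Sum>p\<in>UNIV. svar (group N Z p) (x p N) / real (n N p))" for N Z
  define q where "q = normal_quantile (1 - \<alpha> / 2)"
  have nN: "n N PV1V2 = Nv1 N" "n N PCV2 = Ncv2 N" "n N PCC = Ncc N" for N
    by (simp_all add: n_def)
  have x_mem: "x p \<in> {a, b, d}" for p
  proof -
    have "x PV1V2 = a" "x PCV2 = b" "x PCC = d"
      by (intro ext, simp add: x_def a_def b_def d_def path_outcome_def)+
    then show ?thesis by (cases p) auto
  qed
  have n: "\<forall>\<^sub>F N in sequentially. n N PV1V2 + n N PCV2 + n N PCC = N"
    using sizes by eventually_elim (simp add: nN)
  have good: "\<forall>\<^sub>F N in sequentially. n N PV1V2 + n N PCV2 + n N PCC = N \<and> (\<forall>p. n N p > 0) \<and> N > 0"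
    using sizes eventually_gt_at_top[of 0] by eventually_elim (auto simp: nN path_all)
  have T: "tau_hat N (Nv1 N) (Ncv2 N) (Ncc N) (Y1 N) (Y2 N) Z = tau1 N + S N Z"
    if "n N PV1V2 + n N PCV2 + n N PCC = N" "\<forall>p. n N p > 0" "N > 0" "Z \<in> set_pmf (swd N (n N))" for N Z
    using tau_hat_eq[of N Z "n N" "Y2 N" "Y1 N"] set_pmf_swd[of "n N" N Z] consistency[of _ N V2] that
    by (simp add: nN tau1_def S_def x_def)
  have Veq: "V_hat N (Nv1 N) (Ncv2 N) (Ncc N) (Y1 N) (Y2 N) Z = V N Z" for N Z
    using V_hat_eq[of N "n N" "Y1 N" "Y2 N" Z] by (simp add: nN V_def x_def)
  have varS: "Var_tau_hat N = measure_pmf.expectation (swd N (n N)) (\<lambda>Z. (S N Z)\<^sup>2)"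
    if g: "n N PV1V2 + n N PCV2 + n N PCC = N" "\<forall>p. n N p > 0" "N > 0" for N
  proof -
    let ?D = "swd N (n N)" and ?T = "tau_hat N (Nv1 N) (Ncv2 N) (Ncc N) (Y1 N) (Y2 N)"
    have ES: "measure_pmf.expectation ?D (S N) = 0"
      unfolding S_def
    proof (rule swd_sum_mean_zero[OF g(1), of "\<lambda>i p. path_sign p * (x p N i - pmean N (x p N)) / real (n N p)"])
      show "(\<Sum>i<N. path_sign p * (x p N i - pmean N (x p N)) / real (n N p)) = 0" for p
        using pmean_centred[where x = "x p N" and N = N] by (simp flip: sum_distrib_left sum_divide_distrib)
    qed
    have "measure_pmf.expectation ?D ?T = measure_pmf.expectation ?D (\<lambda>Z. tau1 N + S N Z)"
      by (rule integral_cong_AE) (auto intro!: AE_pmfI simp: T[OF g])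
    also have "\<dots> = tau1 N"
      using ES by (subst Bochner_Integration.integral_add) (auto intro: integrable_swd[OF g(1)])
    finally have ET: "measure_pmf.expectation ?D ?T = tau1 N" .
    have "measure_pmf.expectation ?D (\<lambda>Z. (?T Z - tau1 N)\<^sup>2) = measure_pmf.expectation ?D (\<lambda>Z. (S N Z)\<^sup>2)"
      by (rule integral_cong_AE) (auto intro!: AE_pmfI simp: T[OF g])
    then show ?thesis using ET by (simp add: Var_tau_hat_def Let_def nN)
  qed
  obtain L where L: "L > 0" "(\<lambda>N. real N * Var_tau_hat N) \<longlonglongrightarrow> L"
    using lim_var by blast
  have "\<forall>\<^sub>F N in sequentially. real N * Var_tau_hat N = real N * measure_pmf.expectation (swd N (n N)) (\<lambda>Z. (S N Z)\<^sup>2)"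
    using good by eventually_elim (simp add: varS)
  with L(2) have varL: "(\<lambda>N. real N * measure_pmf.expectation (swd N (n N)) (\<lambda>Z. (S N Z)\<^sup>2)) \<longlonglongrightarrow> L"
    by (rule Lim_transform_eventually)
  have q: "q > 0" "Phi q = 1 - \<alpha> / 2"
    unfolding q_def using alpha by (auto intro!: normal_quantile_pos Phi_normal_quantile)
  have frac: "\<exists>l>0. (\<lambda>N. real (n N p) / real N) \<longlonglongrightarrow> l" for p
    using lim_v1 lim_cv2 lim_cc by (cases p) (auto simp: nN)
  have cover: "\<forall>\<^sub>F N in sequentially. 1 - \<alpha> - e < measure_pmf.prob (swd N (n N)) {Z. \<bar>S N Z\<bar> < q * sqrt (V N Z)}"
    if e: "e > 0" for e
    using wald_coverage[of path_sign n x L q e, folded S_def V_def, OF _ n frac lim_cov[OF x_mem x_mem] lim_max[OF x_mem] varL L(1) q(1) e] q(2)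
    by (auto simp: path_sign_def split: path.splits)
  show ?thesis
    unfolding le_Liminf_iff
  proof (intro allI impI)
    fix u assume u: "u < ereal (1 - \<alpha>)"
    then obtain r where r: "u < ereal r" "r < 1 - \<alpha>"
      using ereal_dense2[OF u] by auto
    have "\<forall>\<^sub>F N in sequentially. r < measure_pmf.prob (swd N (n N)) {Z. \<bar>S N Z\<bar> < q * sqrt (V N Z)}"
      using cover[of "1 - \<alpha> - r"] r by simp
    then show "\<forall>\<^sub>F N in sequentially. u < ereal (measure_pmf.prob (design N (Nv1 N) (Ncv2 N) (Ncc N))
           {Z. let T = tau_hat N (Nv1 N) (Ncv2 N) (Ncc N) (Y1 N) (Y2 N) Z;
                   V = V_hat N (Nv1 N) (Ncv2 N) (Ncc N) (Y1 N) (Y2 N) Z;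
                   q = normal_quantile (1 - \<alpha> / 2) in
               T - q * sqrt V < tau1 N \<and> tau1 N < T + q * sqrt V})"
      using good
    proof eventually_elim
      case (elim N)
      let ?G = "{Z. let T = tau_hat N (Nv1 N) (Ncv2 N) (Ncc N) (Y1 N) (Y2 N) Z;
                   V = V_hat N (Nv1 N) (Ncv2 N) (Ncc N) (Y1 N) (Y2 N) Z;
                   q = normal_quantile (1 - \<alpha> / 2) in
               T - q * sqrt V < tau1 N \<and> tau1 N < T + q * sqrt V}"
      have "measure_pmf.prob (swd N (n N)) {Z. \<bar>S N Z\<bar> < q * sqrt (V N Z)} \<le> measure_pmf.prob (swd N (n N)) ?G"
        by (rule measure_pmf.finite_measure_mono_AE)
          (use elim in \<open>auto intro!: AE_pmfI simp: T Veq q_def[symmetric] abs_less_iff Let_def\<close>)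
      then have "r < measure_pmf.prob (design N (Nv1 N) (Ncv2 N) (Ncc N)) ?G"
        using elim by (simp add: nN)
      then have "ereal r < ereal (measure_pmf.prob (design N (Nv1 N) (Ncv2 N) (Ncc N)) ?G)"
        by simp
      with r(1) show ?case by (rule order_less_trans)
    qed
  qed
qed

end
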